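(* Let $\nu_1,\nu_2\in(0,1)$ be fixed constants and let $k\in[n-1]$. Suppose the tolerance $m$ (an integer with $0\le m\le\min(k-1,n-k-1)$) is bounded by $2m\le(1+\nu_2)^{-1}\min\{n^{1-\nu_1},k,n-k\}$, that $\frac{\log n}{np\varepsilon}<c_0$, and that $\delta<c_0\left(m\log n\cdot n^{10m}/\varepsilon\right)^{-1}$, for a sufficiently small constant $c_0>0$. There is a small constant $c(\nu_1,\nu_2)>0$ such that every $(\varepsilon,\delta)$ edge differentially private estimator $\widehat{\mathcal S}_k$ satisfies $$\sup_{\rho\in\widetilde\Theta(k,m,c)}\Pr_\rho\left(d_H(\widehat{\mathcal S}_k,\mathcal S_k)>2m\right)\ge\frac1{10}$$ whenever $c<c(\nu_1,\nu_2)$ and $n$ is sufficiently large. The inequality remains true if $\rho=(\rho_{ij})_{i,j\in[n]}$ is additionally restricted to the parametric model $\rho_{ij}=F(\theta^*_i-\theta^*_j)$, $\theta^*\in\mathbb R^n$, as long as the (differentiable) function $F:\mathbb R\to[0,1]$ is strictly increasing and satisfies $F(x)=1-F(-x)$ for every $x\in\mathbb R$.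
   Context: Model. There are $n$ items indexed by $[n]=\{1,\dots,n\}$. Each pair $(i,j)$, $1\le i<j\le n$, is compared independently with known probability $p\in(0,1]$; the compared pairs form the edge set of a random graph $\mathcal G$. Given $\mathcal G$, the outcomes $Y_{ij}\in\{0,1\}$, $(i,j)\in\mathcal G$, $i<j$, are independent with $\Pr(Y_{ij}=1)=\rho_{ij}$, and $Y_{ji}=1-Y_{ij}$. Here $\rho=(\rho_{ij})\in[0,1]^{n\times n}$ satisfies $\rho_{ij}+\rho_{ji}=1$, $\rho_{ii}=1/2$; $\Pr_\rho$ is the resulting probability. Let $\tau_i=\frac1n\sum_{j\in[n]}\rho_{ij}$, let $\tau_{(1)}\ge\dots\ge\tau_{(n)}$ be the ordered values, and let $\mathcal S_k$ be the set of the $k$ indices with the largest $\tau_i$ (ties broken by an arbitrary fixed rule). $d_H$ is the Hamming distance between sets (cardinality of the symmetric difference). For $\varepsilon>0$, $$\widetilde\Theta(k,m,c)=\left\{\rho\in[0,1]^{n\times n}:\rho+\rho^\top=\mathbf 1\mathbf 1^\top,\ \tau_{(k-m)}-\tau_{(k+m+1)}\ge c\,\frac{\log n}{np\varepsilon}\right\}.$$ Edge differential privacy. Two comparison data sets $(\mathcal G,(y_{ij})_{(i,j)\in\mathcal G})$ and $(\mathcal G',(y'_{ij})_{(i,j)\in\mathcal G'})$ are adjacent if either $\mathcal G=\mathcal G'$ and the outcomes differ on exactly one edge, or $\mathcal G$ is obtained from $\mathcal G\cap\mathcal G'$ by adding one edge and $\mathcal G'$ by adding one different edge, with all outcomes on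 $\mathcal G\cap\mathcal G'$ equal. A randomized algorithm $M$ is $(\varepsilon,\delta)$ edge differentially private if $\Pr(M(X)\in A)\le e^{\varepsilon}\Pr(M(X')\in A)+\delta$ for all adjacent $X,X'$ and all measurable $A$.
   Formalization: For m = 0 the stated bound on δ divides by zero, and with no bound on δ the claim is false (δ = 1 makes privacy void); for m = 0 the formal theorem instead requires the bound for m = 1, δ < c_0 (log n · n^{10}/ε)^{-1}. *)

theory Defs
  imports "HOL-Probability.Probability"
begin

text \<open>
  Items are the numbers 1, ..., n.  A matrix is a function of two indices, of which only the
  entries with both indices in \<open>{1..n}\<close> are constrained or used.
\<close>

definition comparison_matrices :: "nat \<Rightarrow> (nat \<Rightarrow> nat \<Rightarrow> real) set" where
  "comparison_matrices n =
     {\<rho>. \<forall>i\<in>{1..n}. \<forall>j\<in>{1..n}. \<rho> i j \<in> {0..1} \<and> \<rho> i j + \<rho> j i = 1}"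

definition tau :: "nat \<Rightarrow> (nat \<Rightarrow> nat \<Rightarrow> real) \<Rightarrow> nat \<Rightarrow> real" where
  "tau n \<rho> i = (\<Sum>j\<in>{1..n}. \<rho> i j) / real n"

text \<open>The \<open>l\<close>-th largest score, for \<open>1 \<le> l \<le> n\<close>, counted with multiplicity.\<close>

definition tau_ord :: "nat \<Rightarrow> (nat \<Rightarrow> nat \<Rightarrow> real) \<Rightarrow> nat \<Rightarrow> real" where
  "tau_ord n \<rho> l = rev (sort (map (tau n \<rho>) [1..<n + 1])) ! (l - 1)"

text \<open>
  \<open>Sk\<close> selects, for every \<open>\<rho>\<close>, a set of \<open>k\<close> indices with the largest scores.  The admissible
  \<open>Sk\<close> differ only in how they break ties.
\<close>

definition top_k_rule :: "nat \<Rightarrow> nat \<Rightarrow> ((nat \<Rightarrow> nat \<Rightarrow> real) \<Rightarrow> nat set) \<Rightarrow> bool" where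
  "top_k_rule n k Sk \<longleftrightarrow>
     (\<forall>\<rho>\<in>comparison_matrices n.
        Sk \<rho> \<subseteq> {1..n} \<and> card (Sk \<rho>) = k \<and>
        (\<forall>i\<in>Sk \<rho>. \<forall>j\<in>{1..n} - Sk \<rho>. tau n \<rho> j \<le> tau n \<rho> i))"

definition hamming_dist :: "nat set \<Rightarrow> nat set \<Rightarrow> nat" where
  "hamming_dist A B = card (sym_diff A B)"

definition Theta_tilde ::
  "nat \<Rightarrow> real \<Rightarrow> real \<Rightarrow> nat \<Rightarrow> nat \<Rightarrow> real \<Rightarrow> (nat \<Rightarrow> nat \<Rightarrow> real) set" where
  "Theta_tilde n p \<epsilon> k m c =
     {\<rho> \<in> comparison_matrices n.
        tau_ord n \<rho> (k - m) - tau_ord n \<rho> (k + m + 1) \<ge> c * (ln (real n) / (real n * p * \<epsilon>))}"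

definition parametric_model :: "nat \<Rightarrow> (real \<Rightarrow> real) \<Rightarrow> (nat \<Rightarrow> nat \<Rightarrow> real) set" where
  "parametric_model n F =
     {\<rho>. \<exists>\<theta> :: nat \<Rightarrow> real. \<forall>i\<in>{1..n}. \<forall>j\<in>{1..n}. \<rho> i j = F (\<theta> i - \<theta> j)}"

text \<open>
  A data set is a set \<open>G\<close> of compared pairs \<open>(i, j)\<close>, \<open>i < j\<close>, together with the outcomes on
  \<open>G\<close>, \<open>True\<close> standing for 1.  The outcome of \<open>(j, i)\<close> is the complement and is not stored;
  outside \<open>G\<close> the outcome function has the dummy value \<open>False\<close>, so that equal data sets are
  equal as pairs.
\<close>

type_synonym dataset = "(nat \<times> nat) set \<times> (nat \<times> nat \<Rightarrow> bool)"

definition item_pairs :: "nat \<Rightarrow> (nat \<times> nat) set" where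
  "item_pairs n = {(i, j). 1 \<le> i \<and> i < j \<and> j \<le> n}"

definition datasets :: "nat \<Rightarrow> dataset set" where
  "datasets n = {(G, y). G \<subseteq> item_pairs n \<and> (\<forall>e. e \<notin> G \<longrightarrow> \<not> y e)}"

definition graph_pmf :: "nat \<Rightarrow> real \<Rightarrow> (nat \<times> nat) set pmf" where
  "graph_pmf n p =
     map_pmf (\<lambda>g. {e \<in> item_pairs n. g e}) (Pi_pmf (item_pairs n) False (\<lambda>_. bernoulli_pmf p))"

definition data_pmf :: "nat \<Rightarrow> real \<Rightarrow> (nat \<Rightarrow> nat \<Rightarrow> real) \<Rightarrow> dataset pmf" where
  "data_pmf n p \<rho> =
     bind_pmf (graph_pmf n p) (\<lambda>G.
       map_pmf (\<lambda>y. (G, y)) (Pi_pmf G False (\<lambda>(i, j). bernoulli_pmf (\<rho> i j))))"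

definition adjacent :: "dataset \<Rightarrow> dataset \<Rightarrow> bool" where
  "adjacent X X' \<longleftrightarrow>
     (case (X, X') of ((G, y), (G', y')) \<Rightarrow>
        (G = G' \<and> card {e \<in> G. y e \<noteq> y' e} = 1) \<or>
        (card (G - G') = 1 \<and> card (G' - G) = 1 \<and> (\<forall>e \<in> G \<inter> G'. y e = y' e)))"

text \<open>
  A randomized estimator maps a data set to a distribution on the subsets of \<open>{1..n}\<close>, a finite
  space on which every set is measurable.  Outputs are not required to have \<open>k\<close> elements.
\<close>

definition set_estimator :: "nat \<Rightarrow> (dataset \<Rightarrow> nat set pmf) \<Rightarrow> bool" where
  "set_estimator n M \<longleftrightarrow> (\<forall>X\<in>datasets n. set_pmf (M X) \<subseteq> Pow {1..n})"

definition edge_dp :: "nat \<Rightarrow> real \<Rightarrow> real \<Rightarrow> (dataset \<Rightarrow> nat set pmf) \<Rightarrow> bool" where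
  "edge_dp n \<epsilon> \<delta> M \<longleftrightarrow>
     (\<forall>X\<in>datasets n. \<forall>X'\<in>datasets n. adjacent X X' \<longrightarrow>
        (\<forall>A. measure_pmf.prob (M X) A \<le> exp \<epsilon> * measure_pmf.prob (M X') A + \<delta>))"

text \<open>
  The law of the estimate under \<open>\<rho>\<close>, over both the data and the internal randomness of \<open>M\<close>.
\<close>

definition estimate_pmf ::
  "nat \<Rightarrow> real \<Rightarrow> (nat \<Rightarrow> nat \<Rightarrow> real) \<Rightarrow> (dataset \<Rightarrow> nat set pmf) \<Rightarrow> nat set pmf" where
  "estimate_pmf n p \<rho> M = bind_pmf (data_pmf n p \<rho>) M"

text \<open>
  The constraints on the parameters.  For \<open>m \<ge> 1\<close> the last one is
  \<open>\<delta> < c0 (m log n n^(10 m) / \<epsilon>)^(-1)\<close>.  For \<open>m = 0\<close> that expression is a division by zero, and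
  without any bound on \<open>\<delta>\<close> the lower bound fails (for \<open>\<delta> \<ge> 1\<close> privacy is void); the condition
  for \<open>m = 0\<close> is taken to be the one for \<open>m = 1\<close>.
\<close>

definition admissible ::
  "real \<Rightarrow> real \<Rightarrow> real \<Rightarrow> nat \<Rightarrow> real \<Rightarrow> nat \<Rightarrow> nat \<Rightarrow> real \<Rightarrow> real \<Rightarrow> bool" where
  "admissible \<nu>1 \<nu>2 c0 n p k m \<epsilon> \<delta> \<longleftrightarrow>
     0 < p \<and> p \<le> 1 \<and> 0 < \<epsilon> \<and> 0 \<le> \<delta> \<and>
     k \<in> {1..n - 1} \<and> m \<le> min (k - 1) (n - k - 1) \<and>
     real (2 * m) \<le> inverse (1 + \<nu>2) * min (real n powr (1 - \<nu>1)) (min (real k) (real (n - k))) \<and>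
     ln (real n) / (real n * p * \<epsilon>) < c0 \<and>
     \<delta> < c0 * inverse (real (max m 1) * ln (real n) * real n ^ (10 * max m 1) / \<epsilon>)"

end

theory Submission
  imports Defs
begin

text \<open>
  Let \<open>\<rho>\<^sup>S\<close> have entries \<open>1/2 + h (1\<^sub>S(i) - 1\<^sub>S(j))\<close>.  Its scores take two values, which differ by exactly
  \<open>h\<close>, so \<open>S\<close> is the unique top set; and \<open>\<rho>\<^sup>S\<close> is parametric as soon as \<open>1/2 + h\<close> is a value of \<open>F\<close>.
  Take \<open>h\<close> proportional to \<open>log n / (n p \<epsilon>)\<close> and let \<open>S\<close> range over the sets obtained from a fixed \<open>V\<close>
  by adding (if \<open>k \<le> n/2\<close>) or removing (otherwise) one item from each of \<open>s\<close> disjoint blocks of length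
  \<open>q \<ge> n\<^bsup>\<nu>1/2\<^esup>\<close>, where \<open>s - 2m\<close> is positive and at least \<open>\<nu>2 s / 3\<close>.  A single output is within distance
  \<open>2m\<close> of at most \<open>2\<^sup>s q\<^bsup>2m\<^esup>\<close> of these \<open>q\<^sup>s\<close> sets.

  Compare every \<open>\<rho>\<^sup>S\<close> with the reference \<open>\<rho>\<^sup>V\<close>.  They differ, by at most \<open>h\<close>, only on the at most \<open>s n\<close> pairs
  touching the selected items, of which with probability at least \<open>1/2\<close> no more than
  \<open>2 s n p\<close> are compared.  Given such a graph the probability of any event about the output grows by at most a
  factor \<open>n\<^bsup>O(c s)\<^esup>\<close>, up to a small additive error.  Success with probability above \<open>9/10\<close> for
  every \<open>S\<close> would therefore force \<open>q\<^bsup>s - 2m\<^esup> \<le> 2\<^sup>s n\<^bsup>O(c s)\<^esup>\<close>, which is false for small \<open>c\<close>.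
\<close>

subsection \<open>Functions of independent bits\<close>

lemma finite_set_Pi_pmf_bool:
  fixes p :: "'a \<Rightarrow> bool pmf"
  assumes "finite A"
  shows "finite (set_pmf (Pi_pmf A d p))"
proof -
  have "finite (PiE_dflt A d (set_pmf \<circ> p))"
    using assms by (intro finite_PiE_dflt) auto
  then show ?thesis
    using assms by (simp add: set_Pi_pmf)
qed

lemma prob_bind_pmf:
  "measure_pmf.prob (bind_pmf P K) A = measure_pmf.expectation P (\<lambda>x. measure_pmf.prob (K x) A)"
proof -
  have "ennreal (measure_pmf.prob (bind_pmf P K) A) = emeasure (bind_pmf P K) A"
    by (simp add: measure_pmf.emeasure_eq_measure)
  also have "\<dots> = (\<integral>\<^sup>+x. ennreal (measure_pmf.prob (K x) A) \<partial>P)"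
    by (simp flip: measure_pmf.emeasure_eq_measure)
  also have "\<dots> = ennreal (measure_pmf.expectation P (\<lambda>x. measure_pmf.prob (K x) A))"
    by (intro nn_integral_eq_integral measure_pmf.integrable_const_bound[where B = 1]) auto
  finally show ?thesis
    by (subst (asm) ennreal_inj) auto
qed

lemma expectation_mono_finite:
  fixes f g :: "'a \<Rightarrow> real"
  assumes "finite (set_pmf P)" and "\<And>x. x \<in> set_pmf P \<Longrightarrow> f x \<le> g x"
  shows "measure_pmf.expectation P f \<le> measure_pmf.expectation P g"
  using assms by (intro integral_mono_AE integrable_measure_pmf_finite) (auto simp: AE_measure_pmf_iff)

text \<open>Bits outside \<open>A\<close> take the default \<open>False\<close>, the dummy outcome
  that \<open>datasets\<close> prescribes off the graph.\<close>

abbreviation expect_bits :: "'a set \<Rightarrow> ('a \<Rightarrow> real) \<Rightarrow> (('a \<Rightarrow> bool) \<Rightarrow> real) \<Rightarrow> real" where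
  "expect_bits A r g \<equiv> measure_pmf.expectation (Pi_pmf A False (\<lambda>e. bernoulli_pmf (r e))) g"

text \<open>Integrating out the bit \<open>e\<close> first leaves a function of the remaining bits.
  Both inductions below peel off coordinates this way, hence with \<open>g\<close>
  arbitrary.\<close>

lemma expect_bits_insert:
  assumes "finite A" "e \<notin> A" "r e \<in> {0..1}"
  shows "expect_bits (insert e A) r g =
         expect_bits A r (\<lambda>y. r e * g (y(e := True)) + (1 - r e) * g (y(e := False)))"
proof -
  let ?P = "Pi_pmf A False (\<lambda>e. bernoulli_pmf (r e))"
  have "Pi_pmf (insert e A) False (\<lambda>e. bernoulli_pmf (r e))
      = ?P \<bind> (\<lambda>y. map_pmf (\<lambda>b. y(e := b)) (bernoulli_pmf (r e)))"
    using assms by (simp add: Pi_pmf_insert' map_pmf_def bind_commute_pmf[of "bernoulli_pmf (r e)"])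
  then have "expect_bits (insert e A) r g =
      (\<Sum>y\<in>set_pmf ?P. pmf ?P y *\<^sub>R
         measure_pmf.expectation (map_pmf (\<lambda>b. y(e := b)) (bernoulli_pmf (r e))) g)"
    using assms finite_set_Pi_pmf_bool[of A]
    by (simp add: pmf_expectation_bind[where A = "set_pmf ?P"])
  also have "\<dots> = (\<Sum>y\<in>set_pmf ?P. pmf ?P y *\<^sub>R
         (r e * g (y(e := True)) + (1 - r e) * g (y(e := False))))"
    using assms by (intro sum.cong) (auto simp: algebra_simps)
  also have "\<dots> = expect_bits A r (\<lambda>y. r e * g (y(e := True)) + (1 - r e) * g (y(e := False)))"
    by (rule integral_measure_pmf[symmetric]) (auto simp: finite_set_Pi_pmf_bool assms)
  finally show ?thesis .
qed

lemma expect_bits_mono: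
  assumes "finite A" "\<And>y. f y \<le> g y"
  shows "expect_bits A r f \<le> expect_bits A r g"
  using assms by (intro expectation_mono_finite finite_set_Pi_pmf_bool) auto

lemma expect_bits_affine:
  assumes "finite A"
  shows "expect_bits A r (\<lambda>y. a * f y + b) = a * expect_bits A r f + b"
  using assms by (simp add: integrable_measure_pmf_finite finite_set_Pi_pmf_bool)

text \<open>Replacing the law of one coordinate \<open>e\<close> moves the mean by
  \<open>(r' e - r e) (g\<^sub>1 - g\<^sub>0)\<close>, and privacy bounds \<open>\<bar>g\<^sub>1 - g\<^sub>0\<bar>\<close> by
  \<open>(e\<^sup>\<epsilon> - 1) min g\<^sub>0 g\<^sub>1 + \<delta>\<close>.\<close>

lemma expect_bits_private_le:
  fixes g :: "('a \<Rightarrow> bool) \<Rightarrow> real"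
  assumes "finite A" and "\<And>e. e \<in> A \<Longrightarrow> r e \<in> {0..1} \<and> r' e \<in> {0..1}"
    and "\<And>e. e \<in> A \<Longrightarrow> \<bar>r' e - r e\<bar> \<le> h"
    and "\<And>e. e \<in> A - K \<Longrightarrow> r' e = r e"
    and "\<And>y. g y \<ge> 0"
    and "\<And>y e b. e \<in> A \<Longrightarrow> g (y(e := b)) \<le> exp \<epsilon> * g (y(e := \<not> b)) + \<delta>"
    and "0 \<le> h" "0 \<le> \<epsilon>" "0 \<le> \<delta>"
  shows "expect_bits A r' g \<le>
    (1 + h * (exp \<epsilon> - 1)) ^ card (A \<inter> K) * (expect_bits A r g + real (card (A \<inter> K)) * (h * \<delta>))"
  using assms(1-6)
proof (induction A arbitrary: g rule: finite_induct)
  case empty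
  then show ?case by simp
next
  case (insert e A)
  define \<eta> where "\<eta> = 1 + h * (exp \<epsilon> - 1)"
  define D where "D = card (A \<inter> K)"
  have \<eta>: "\<eta> \<ge> 1" using assms(7,8) by (simp add: \<eta>_def)
  \<comment> \<open>\<open>G s\<close> averages \<open>g\<close> over the bit \<open>e\<close> with
    success probability \<open>s\<close>. Nonnegativity and the flip bound survive convex
    combinations, so the induction hypothesis applies to \<open>G s\<close>.\<close>
  define G where "G s y = s * g (y(e := True)) + (1 - s) * g (y(e := False))" for s y
  have re: "r e \<in> {0..1}" "r' e \<in> {0..1}" using insert.prems(1) by auto
  have nonneg: "G s y \<ge> 0" if "s \<in> {0..1}" for s y
    using that insert.prems(4) by (simp add: G_def)
  have dpG: "G s (y(x := b)) \<le> exp \<epsilon> * G s (y(x := \<not> b)) + \<delta>"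
    if "x \<in> A" "s \<in> {0..1}" for x y b s
  proof -
    have ne: "x \<noteq> e" using that insert.hyps by auto
    have 1: "g ((y(e := c))(x := b)) \<le> exp \<epsilon> * g ((y(e := c))(x := \<not> b)) + \<delta>" for c
      using insert.prems(5) that by blast
    have "s * g ((y(e := True))(x := b)) + (1 - s) * g ((y(e := False))(x := b))
      \<le> s * (exp \<epsilon> * g ((y(e := True))(x := \<not> b)) + \<delta>)
        + (1 - s) * (exp \<epsilon> * g ((y(e := False))(x := \<not> b)) + \<delta>)"
      using that 1[of True] 1[of False] by (intro add_mono mult_left_mono) auto
    then show ?thesis
      using ne by (simp add: G_def fun_upd_twist algebra_simps)
  qed
  have IH: "expect_bits A r' (G (r' e)) \<le> \<eta> ^ D * (expect_bits A r (G (r' e)) + real D * (h * \<delta>))"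
    unfolding \<eta>_def D_def using insert.prems(1-3) nonneg[OF re(2)] dpG[OF _ re(2)]
    by (intro insert.IH) blast+
  have E: "expect_bits (insert e A) r' g = expect_bits A r' (G (r' e))"
          "expect_bits (insert e A) r g = expect_bits A r (G (r e))"
    using insert.hyps re by (simp_all add: expect_bits_insert G_def[abs_def])
  show ?case
  proof (cases "e \<in> K")
    case False
    then have "r' e = r e" using insert.prems(3) by auto
    then show ?thesis
      using IH E False by (simp add: \<eta>_def D_def)
  next
    case True
    have step: "G (r' e) y \<le> \<eta> * G (r e) y + h * \<delta>" for y
    proof -
      define a b where "a = g (y(e := True))" and "b = g (y(e := False))"
      have ab: "a \<le> exp \<epsilon> * b + \<delta>" "b \<le> exp \<epsilon> * a + \<delta>" "a \<ge> 0" "b \<ge> 0"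
        using insert.prems(5)[of e y True] insert.prems(5)[of e y False] insert.prems(4)
        by (auto simp: a_def b_def fun_upd_def)
      \<comment> \<open>A mean dominates the minimum; this turns the bound by \<open>min a b\<close>
        into one by \<open>G (r e) y\<close>, which integrates to the mean under
        \<open>r\<close>.\<close>
      have min1: "min a b \<le> G (r e) y"
      proof -
        have "r e * min a b + (1 - r e) * min a b \<le> r e * a + (1 - r e) * b"
          using re by (intro add_mono mult_left_mono) auto
        then show ?thesis by (simp add: G_def a_def b_def algebra_simps)
      qed
      have "\<bar>a - b\<bar> \<le> (exp \<epsilon> - 1) * min a b + \<delta>"
        using ab by (auto simp: min_def abs_if algebra_simps)
      also have "\<dots> \<le> (exp \<epsilon> - 1) * G (r e) y + \<delta>"
        using min1 assms(8) by (intro add_right_mono mult_left_mono) auto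
      finally have *: "\<bar>a - b\<bar> \<le> (exp \<epsilon> - 1) * G (r e) y + \<delta>" .
      have "G (r' e) y - G (r e) y = (r' e - r e) * (a - b)"
        by (simp add: G_def a_def b_def algebra_simps)
      also have "\<dots> \<le> \<bar>r' e - r e\<bar> * \<bar>a - b\<bar>"
        by (metis abs_ge_self abs_mult)
      also have "\<dots> \<le> h * ((exp \<epsilon> - 1) * G (r e) y + \<delta>)"
        using insert.prems(2)[of e] * by (intro mult_mono) (auto simp: assms)
      finally show ?thesis by (simp add: \<eta>_def algebra_simps)
    qed
    have "expect_bits A r (G (r' e)) \<le> expect_bits A r (\<lambda>y. \<eta> * G (r e) y + h * \<delta>)"
      using insert.hyps step by (intro expect_bits_mono) auto
    also have "\<dots> = \<eta> * expect_bits A r (G (r e)) + h * \<delta>"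
      using insert.hyps by (simp add: expect_bits_affine)
    finally have "\<eta> ^ D * (expect_bits A r (G (r' e)) + real D * (h * \<delta>))
        \<le> \<eta> ^ D * (\<eta> * expect_bits A r (G (r e)) + h * \<delta> + real D * (h * \<delta>))"
      using \<eta> by (intro mult_left_mono) auto
    \<comment> \<open>Inflating the additive error by \<eta> \<ge> 1 lets it share the factor of the
      main term, so the recursion closes.\<close>
    also have "\<dots> \<le> \<eta> ^ D * (\<eta> * expect_bits A r (G (r e)) + \<eta> * (h * \<delta> + real D * (h * \<delta>)))"
    proof -
      have "h * \<delta> + real D * (h * \<delta>) \<le> \<eta> * (h * \<delta> + real D * (h * \<delta>))"
        using \<eta> assms by (intro mult_right_mono[of 1 \<eta>, simplified]) auto
      then show ?thesis using \<eta> by (intro mult_left_mono) auto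
    qed
    also have "\<dots> = \<eta> ^ Suc D * (expect_bits A r (G (r e)) + real (Suc D) * (h * \<delta>))"
      by (simp add: algebra_simps)
    also have "Suc D = card (insert e A \<inter> K)"
      using True insert.hyps by (simp add: D_def)
    finally show ?thesis using IH E by (simp add: \<eta>_def)
  qed
qed

text \<open>Cauchy--Schwarz, tensorised: the factor is the chi-square divergence of product measures.\<close>

lemma expect_bits_chi_square:
  fixes g :: "('a \<Rightarrow> bool) \<Rightarrow> real"
  assumes "finite A" and "\<And>e. e \<in> A \<Longrightarrow> r e \<in> {1/4..3/4} \<and> r' e \<in> {0..1}"
    and "\<And>e. e \<in> A \<Longrightarrow> \<bar>r' e - r e\<bar> \<le> h"
    and "\<And>e. e \<in> A - K \<Longrightarrow> r' e = r e"
  shows "(expect_bits A r' g)\<^sup>2 \<le> (1 + 8 * h\<^sup>2) ^ card (A \<inter> K) * expect_bits A r (\<lambda>y. (g y)\<^sup>2)"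
  using assms
proof (induction A arbitrary: g rule: finite_induct)
  case empty
  then show ?case by simp
next
  case (insert e A)
  define G where "G s f y = s * f (y(e := True)) + (1 - s) * f (y(e := False))"
    for s and f :: "('a \<Rightarrow> bool) \<Rightarrow> real" and y
  define g2 where "g2 = (\<lambda>y. (g y)\<^sup>2)"
  have re: "r e \<in> {1/4..3/4}" "r' e \<in> {0..1}" using insert.prems(1) by auto
  have IH: "(expect_bits A r' (G (r' e) g))\<^sup>2
      \<le> (1 + 8 * h\<^sup>2) ^ card (A \<inter> K) * expect_bits A r (\<lambda>y. (G (r' e) g y)\<^sup>2)"
    using insert.prems by (intro insert.IH) auto
  have E: "expect_bits (insert e A) r' g = expect_bits A r' (G (r' e) g)"
          "expect_bits (insert e A) r g2 = expect_bits A r (G (r e) g2)"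
    using insert.hyps re by (simp_all add: expect_bits_insert G_def[abs_def])
  define w where "w = (if e \<in> K then 1 + 8 * h\<^sup>2 else 1)"
  have step: "(G (r' e) g y)\<^sup>2 \<le> w * G (r e) g2 y" for y
  proof -
    define a b where "a = g (y(e := True))" and "b = g (y(e := False))"
    define s d where "s = r e" and "d = r' e - r e"
    have s: "s \<ge> 1/4" "s \<le> 3/4" using re by (auto simp: s_def)
    \<comment> \<open>Source of the constant 8: on [1/4, 3/4] the variance
      \<open>s * (1 - s)\<close> is at least 3/16 > 1/8, so the chi-square divergence
      \<open>d\<^sup>2 / (s * (1 - s))\<close> of one bit is at most
      \<open>8 * d\<^sup>2\<close>.\<close>
    have "(s - 1/4) * (3/4 - s) = s * (1 - s) - 3/16" by (simp add: field_simps)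
    moreover have "0 \<le> (s - 1/4) * (3/4 - s)" using s by simp
    ultimately have s2: "8 * (s * (1 - s)) \<ge> 1" by linarith
    have "d\<^sup>2 \<le> 8 * (s * (1 - s)) * d\<^sup>2"
      using mult_right_mono[OF s2, of "d\<^sup>2"] by simp
    moreover have "8 * d\<^sup>2 \<le> (w - 1)"
    proof (cases "e \<in> K")
      case True
      have "d\<^sup>2 \<le> h\<^sup>2" using insert.prems(2)[of e]
        by (metis d_def insertI1 abs_le_square_iff abs_ge_self order_trans)
      then show ?thesis using True by (simp add: w_def)
    next
      case False
      then show ?thesis using insert.prems(3)[of e] by (simp add: w_def d_def)
    qed
    ultimately have d: "d\<^sup>2 \<le> (w - 1) * (s * (1 - s))"
      using mult_right_mono[of "8 * d\<^sup>2" "w - 1" "s * (1 - s)"] s by (simp add: algebra_simps)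
    \<comment> \<open>Cauchy-Schwarz for one bit, multiplied by the variance and written as a
      Lagrange identity: the defect is the square subtracted at the end.\<close>
    have id: "((s + d) * a + (1 - s - d) * b)\<^sup>2 * (s * (1 - s))
        = (s * a\<^sup>2 + (1 - s) * b\<^sup>2) * (s * (1 - s) + d\<^sup>2)
          - (s * (1 - s) * (a - b) - d * (s * a + (1 - s) * b))\<^sup>2"
      by (simp add: power2_eq_square algebra_simps)
    have "((s + d) * a + (1 - s - d) * b)\<^sup>2 * (s * (1 - s))
        \<le> (s * a\<^sup>2 + (1 - s) * b\<^sup>2) * (s * (1 - s) + d\<^sup>2)"
      unfolding id by simp
    also have "\<dots> \<le> (s * a\<^sup>2 + (1 - s) * b\<^sup>2) * (w * (s * (1 - s)))"
    proof (rule mult_left_mono)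
      show "s * (1 - s) + d\<^sup>2 \<le> w * (s * (1 - s))" using d by (simp add: algebra_simps)
      show "0 \<le> s * a\<^sup>2 + (1 - s) * b\<^sup>2" using s by simp
    qed
    also have "\<dots> = w * (s * a\<^sup>2 + (1 - s) * b\<^sup>2) * (s * (1 - s))"
      by (simp only: ac_simps)
    finally have "((s + d) * a + (1 - s - d) * b)\<^sup>2 \<le> w * (s * a\<^sup>2 + (1 - s) * b\<^sup>2)"
      using s by (elim mult_right_le_imp_le) simp
    then show ?thesis
      by (simp add: G_def a_def b_def s_def d_def g2_def)
  qed
  have "w \<ge> 0" by (simp add: w_def)
  have "expect_bits A r (\<lambda>y. (G (r' e) g y)\<^sup>2) \<le> expect_bits A r (\<lambda>y. w * G (r e) g2 y + 0)"
    using step insert.hyps by (intro expect_bits_mono) auto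
  also have "\<dots> = w * expect_bits A r (G (r e) g2)"
    using insert.hyps by (subst expect_bits_affine) auto
  finally have "(1 + 8 * h\<^sup>2) ^ card (A \<inter> K) * expect_bits A r (\<lambda>y. (G (r' e) g y)\<^sup>2)
      \<le> (1 + 8 * h\<^sup>2) ^ card (A \<inter> K) * (w * expect_bits A r (G (r e) g2))"
    by (intro mult_left_mono) auto
  also have "\<dots> = (1 + 8 * h\<^sup>2) ^ card (insert e A \<inter> K) * expect_bits A r (G (r e) g2)"
    using insert.hyps by (auto simp: w_def)
  finally show ?case using IH E by (simp add: g2_def)
qed

subsection \<open>Choosing one item from each block\<close>

text \<open>The items \<open>1, \<dots>, s q\<close> form \<open>s\<close> consecutive blocks of length \<open>q\<close>; \<open>f\<close> selects one item
  from each.\<close>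

definition block_set :: "nat \<Rightarrow> nat \<Rightarrow> (nat \<Rightarrow> nat) \<Rightarrow> nat set" where
  "block_set s q f = (\<lambda>b. b * q + f b + 1) ` {..<s}"

abbreviation choices :: "nat \<Rightarrow> nat \<Rightarrow> (nat \<Rightarrow> nat) set" where
  "choices s q \<equiv> {..<s} \<rightarrow>\<^sub>E {..<q}"

lemma block_eq_iff:
  fixes b b' q j j' :: nat
  assumes "j < q" "j' < q" "b * q + j = b' * q + j'"
  shows "b = b' \<and> j = j'"
proof -
  have "(b * q + j) div q = b" "(b' * q + j') div q = b'"
    using assms(1,2) by simp_all
  then have "b = b'" using assms(3) by simp
  then show ?thesis using assms(3) by simp
qed

lemma block_set_subset:
  assumes "f \<in> choices s q"
  shows "block_set s q f \<subseteq> {1..s * q}"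
proof
  fix x assume "x \<in> block_set s q f"
  then obtain b where b: "b < s" "x = b * q + f b + 1"
    by (auto simp: block_set_def)
  have "f b < q" using assms b by auto
  moreover have "Suc b * q \<le> s * q" using b by (intro mult_right_mono) auto
  ultimately show "x \<in> {1..s * q}" using b by simp
qed

lemma card_block_set:
  assumes "f \<in> choices s q"
  shows "card (block_set s q f) = s"
proof -
  have "inj_on (\<lambda>b. b * q + f b + 1) {..<s}"
  proof (rule inj_onI)
    fix b b' assume "b \<in> {..<s}" "b' \<in> {..<s}" "b * q + f b + 1 = b' * q + f b' + 1"
    then show "b = b'" using assms block_eq_iff[of "f b" q "f b'" b b'] by (auto simp: PiE_iff)
  qed
  then show ?thesis by (simp add: block_set_def card_image)
qed

text \<open>Each block where \<open>T\<close> is not exactly the chosen singleton costs at least one element of the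
  symmetric difference, and on the other blocks \<open>T\<close> determines the choice.\<close>

lemma card_choices_near_le:
  assumes "finite T" "q \<ge> 1"
  shows "card {f \<in> choices s q. card (sym_diff T (block_set s q f)) \<le> d} \<le> 2 ^ s * q ^ d"
    (is "card ?F \<le> _")
proof -
  define blk where "blk b = (\<lambda>j. b * q + j + 1) ` {..<q}" for b
  define W where "W f = {b \<in> {..<s}. T \<inter> blk b \<noteq> {b * q + f b + 1}}" for f
  have blk_disj: "b = b'" if "x \<in> blk b" "x \<in> blk b'" for x b b'
    using that block_eq_iff[of _ q] by (auto simp: blk_def)
  have mem: "b * q + f b + 1 \<in> blk b" if "f \<in> choices s q" "b < s" for f b
    using that by (auto simp: blk_def)
  have only: "x = b * q + f b + 1" if f: "f \<in> choices s q" and "b < s"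
    and x: "x \<in> block_set s q f" "x \<in> blk b" for f b x
  proof -
    obtain b' where b': "b' < s" "x = b' * q + f b' + 1"
      using x by (auto simp: block_set_def)
    then have "b' = b" using blk_disj mem[OF f] x by blast
    then show ?thesis using b' by simp
  qed
  have cardW: "card (W f) \<le> card (sym_diff T (block_set s q f))" if f: "f \<in> choices s q" for f
  proof -
    have "\<exists>x. x \<in> sym_diff T (block_set s q f) \<and> x \<in> blk b" if "b \<in> W f" for b
    proof (rule ccontr)
      assume "\<not> ?thesis"
      then have "T \<inter> blk b = block_set s q f \<inter> blk b" by blast
      also have "\<dots> = {b * q + f b + 1}"
      proof
        have b: "b < s" using that by (simp add: W_def)
        then show "block_set s q f \<inter> blk b \<subseteq> {b * q + f b + 1}" using only[OF f] by blast
        show "{b * q + f b + 1} \<subseteq> block_set s q f \<inter> blk b"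
          using b mem[OF f b] by (auto simp: block_set_def)
      qed
      finally show False using that by (simp add: W_def)
    qed
    then obtain x where x: "\<And>b. b \<in> W f \<Longrightarrow> x b \<in> sym_diff T (block_set s q f) \<and> x b \<in> blk b"
      by metis
    then have "inj_on x (W f)" by (intro inj_onI) (metis blk_disj)
    moreover have "x ` W f \<subseteq> sym_diff T (block_set s q f)" using x by blast
    moreover have "finite (sym_diff T (block_set s q f))"
      using assms by (simp add: block_set_def)
    ultimately show ?thesis by (metis card_inj_on_le)
  qed
  \<comment> \<open>The code of a choice: its set of mismatched blocks (at most \<open>2 ^ s\<close>
    possibilities) and its values on them (at most \<open>q ^ d\<close>).\<close>
  define C where "C = Sigma {X \<in> Pow {..<s}. card X \<le> d} (\<lambda>X. X \<rightarrow>\<^sub>E {..<q})"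
  have "inj_on (\<lambda>f. (W f, restrict f (W f))) ?F"
  proof (rule inj_onI)
    fix f g assume f: "f \<in> ?F" and g: "g \<in> ?F"
      and eq: "(W f, restrict f (W f)) = (W g, restrict g (W g))"
    show "f = g"
    proof (rule PiE_ext)
      show "f \<in> choices s q" "g \<in> choices s q" using f g by auto
      fix b assume b: "b \<in> {..<s}"
      show "f b = g b"
      proof (cases "b \<in> W f")
        case True
        then show ?thesis using eq by (metis prod.inject restrict_apply')
      next
        case False
        then have "b \<notin> W g" using eq by simp
        with False b have "{b * q + f b + 1} = {b * q + g b + 1}"
          unfolding W_def by blast
        then show ?thesis by simp
      qed
    qed
  qed
  moreover have "(\<lambda>f. (W f, restrict f (W f))) ` ?F \<subseteq> C"
  proof
    fix z assume "z \<in> (\<lambda>f. (W f, restrict f (W f))) ` ?F"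
    then obtain f where f: "f \<in> choices s q" "card (sym_diff T (block_set s q f)) \<le> d"
      and z: "z = (W f, restrict f (W f))" by auto
    have "W f \<subseteq> {..<s}" by (auto simp: W_def)
    moreover have "card (W f) \<le> d" using cardW[OF f(1)] f(2) by linarith
    moreover have "restrict f (W f) \<in> W f \<rightarrow>\<^sub>E {..<q}"
      using f(1) \<open>W f \<subseteq> {..<s}\<close> by (auto simp: restrict_PiE_iff PiE_iff)
    ultimately show "z \<in> C" by (simp add: C_def z)
  qed
  moreover have fin: "finite C"
    unfolding C_def by (intro finite_SigmaI finite_PiE) (auto intro: finite_subset)
  ultimately have "card ?F \<le> card C" by (rule card_inj_on_le)
  also have "card C = (\<Sum>X\<in>{X \<in> Pow {..<s}. card X \<le> d}. card (X \<rightarrow>\<^sub>E {..<q}))"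
    unfolding C_def by (intro card_SigmaI) (auto intro!: finite_PiE intro: finite_subset)
  also have "\<dots> \<le> (\<Sum>X\<in>{X \<in> Pow {..<s}. card X \<le> d}. q ^ d)"
  proof (rule sum_mono)
    fix X assume X: "X \<in> {X \<in> Pow {..<s}. card X \<le> d}"
    then have "finite X" by (auto intro: finite_subset)
    then have "card (X \<rightarrow>\<^sub>E {..<q}) = q ^ card X" by (simp add: card_PiE)
    also have "\<dots> \<le> q ^ d" using X assms by (intro power_increasing) auto
    finally show "card (X \<rightarrow>\<^sub>E {..<q}) \<le> q ^ d" .
  qed
  also have "\<dots> \<le> card (Pow {..<s}) * q ^ d"
    unfolding sum_constant of_nat_id by (intro mult_right_mono card_mono) auto
  also have "\<dots> = 2 ^ s * q ^ d" by (simp add: card_Pow)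
  finally show ?thesis .
qed

subsection \<open>Two-level comparison matrices\<close>

definition two_level :: "nat set \<Rightarrow> real \<Rightarrow> nat \<Rightarrow> nat \<Rightarrow> real" where
  "two_level S h i j = 1/2 + h * (indicator S i - indicator S j)"

text \<open>Staying away from 0 and 1 keeps the variance of every outcome bounded below, as the
  chi-square bound requires.\<close>

lemma two_level_mem:
  assumes "0 \<le> h" "h \<le> 1/4"
  shows "two_level S h i j \<in> {1/4..3/4}"
  using assms by (auto simp: two_level_def indicator_def)

lemma two_level_comparison:
  assumes "0 \<le> h" "h \<le> 1/4"
  shows "two_level S h \<in> comparison_matrices n"
  using assms by (auto simp: comparison_matrices_def two_level_def indicator_def)

lemma tau_two_level:
  assumes "S \<subseteq> {1..n}" "n > 0"
  shows "tau n (two_level S h) i = 1/2 + h * (indicator S i - real (card S) / real n)"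
proof -
  have "(\<Sum>j\<in>{1..n}. indicator S j) = real (card S)"
    using assms by (simp add: sum.If_cases indicator_def Int_absorb1 Int_def[symmetric])
  then have "(\<Sum>j\<in>{1..n}. two_level S h i j)
      = real n * (1/2) + h * (real n * indicator S i - real (card S))"
    by (simp add: two_level_def sum.distrib sum_subtractf flip: sum_distrib_left)
  then show ?thesis
    using assms by (simp add: tau_def field_simps)
qed

text \<open>Scores are constant on \<open>S\<close> and off \<open>S\<close>, and
  \<open>h \<ge> 0\<close> fixes which constant is larger. The sorted list is therefore two constant
  runs, with the jump right after position \<open>card S\<close>.\<close>

lemma tau_ord_two_level:
  assumes "S \<subseteq> {1..n}" "0 \<le> h" "1 \<le> l" "l \<le> n"
  shows "tau_ord n (two_level S h) l
    = 1/2 + h * ((if l \<le> card S then 1 else 0) - real (card S) / real n)"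
proof -
  define v where "v x = 1/2 + h * (x - real (card S) / real n)" for x :: real
  have n: "n > 0" using assms by auto
  have v01: "v 0 \<le> v 1" using assms by (simp add: v_def algebra_simps)
  have fin: "finite S" using assms finite_subset by blast
  have cS: "card S \<le> n" using card_mono[OF _ assms(1)] by simp
  have "mset (map (tau n (two_level S h)) [1..<n + 1])
      = image_mset (\<lambda>i. v (indicator S i)) (mset_set {1..n})"
    unfolding mset_map mset_upt v_def
    using assms n
    by (auto intro!: image_mset_cong simp: tau_two_level atLeastLessThanSuc_atLeastAtMost simp del: mset_upt)
  also have "mset_set {1..n} = mset_set S + mset_set ({1..n} - S)"
    using assms fin by (subst mset_set_Union[symmetric]) (auto simp: Un_absorb1)
  also have "image_mset (\<lambda>i. v (indicator S i)) \<dots>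
      = image_mset (\<lambda>i. v 1) (mset_set S) + image_mset (\<lambda>i. v 0) (mset_set ({1..n} - S))"
    using fin by (auto intro!: arg_cong2[where f = "(+)"] image_mset_cong)
  also have "\<dots> = mset (replicate (n - card S) (v 0) @ replicate (card S) (v 1))"
    using assms fin by (simp add: image_mset_const_eq card_Diff_subset)
  finally have "sort (map (tau n (two_level S h)) [1..<n + 1])
      = replicate (n - card S) (v 0) @ replicate (card S) (v 1)"
    using v01 by (intro properties_for_sort) (auto simp: sorted_append)
  then have "tau_ord n (two_level S h) l
      = (replicate (card S) (v 1) @ replicate (n - card S) (v 0)) ! (l - 1)"
    by (simp add: tau_ord_def)
  then show ?thesis
    using assms cS by (auto simp: nth_append v_def)
qed

text \<open>The bounds on \<open>m\<close> keep the positions \<open>k - m\<close> and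
  \<open>k + m + 1\<close> inside 1, ..., n. They lie on opposite sides of the jump, so the gap is
  \<open>h\<close> for every such \<open>m\<close>.\<close>

lemma two_level_Theta:
  assumes "S \<subseteq> {1..n}" "card S = k" "0 \<le> h" "h \<le> 1/4"
    and "1 \<le> k" "k < n" "m \<le> k - 1" "m \<le> n - k - 1"
    and "c * (ln (real n) / (real n * p * \<epsilon>)) \<le> h"
  shows "two_level S h \<in> Theta_tilde n p \<epsilon> k m c"
proof -
  have "tau_ord n (two_level S h) (k - m) - tau_ord n (two_level S h) (k + m + 1) = h"
  proof -
    have "tau_ord n (two_level S h) (k - m) = 1/2 + h * (1 - real k / real n)"
      using assms tau_ord_two_level[of S n h "k - m"] by simp
    moreover have "tau_ord n (two_level S h) (k + m + 1) = 1/2 + h * (0 - real k / real n)"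
      using assms tau_ord_two_level[of S n h "k + m + 1"] by simp
    ultimately show ?thesis by (simp only: right_diff_distrib)
  qed
  then show ?thesis
    using assms two_level_comparison by (simp add: Theta_tilde_def)
qed

text \<open>For \<open>h > 0\<close> no item of \<open>S\<close> ties with an item outside, so tie
  breaking has no influence: another set of size \<open>k\<close> would contain some
  \<open>i\<close> outside \<open>S\<close> and miss some \<open>j\<close> in \<open>S\<close> with
  a larger score.\<close>

lemma top_k_two_level:
  assumes rule: "top_k_rule n k Sk" and S: "S \<subseteq> {1..n}" "card S = k" and h: "0 < h" "h \<le> 1/4"
    and n: "n > 0"
  shows "Sk (two_level S h) = S"
proof (rule ccontr)
  let ?\<rho> = "two_level S h"
  assume ne: "Sk ?\<rho> \<noteq> S"
  have "?\<rho> \<in> comparison_matrices n" using h by (intro two_level_comparison) auto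
  with rule have T: "Sk ?\<rho> \<subseteq> {1..n}" "card (Sk ?\<rho>) = k"
    "\<And>i j. i \<in> Sk ?\<rho> \<Longrightarrow> j \<in> {1..n} - Sk ?\<rho> \<Longrightarrow> tau n ?\<rho> j \<le> tau n ?\<rho> i"
    by (auto simp: top_k_rule_def)
  have fin: "finite S" "finite (Sk ?\<rho>)" using S T finite_subset by blast+
  obtain i where i: "i \<in> Sk ?\<rho>" "i \<notin> S"
    using card_subset_eq[OF fin(1), of "Sk ?\<rho>"] T(2) S(2) ne by auto
  obtain j where j: "j \<in> S" "j \<notin> Sk ?\<rho>"
    using card_subset_eq[OF fin(2), of S] T(2) S(2) ne by auto
  have "tau n ?\<rho> j \<le> tau n ?\<rho> i" using T(3) i j S by blast
  then show False using i j h S n by (simp add: tau_two_level algebra_simps)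
qed

text \<open>Give the items of \<open>S\<close> the parameter \<open>g\<close> and all others 0. Only
  \<open>F 0\<close>, \<open>F g\<close> and \<open>F (- g)\<close> occur, and the symmetry of
  \<open>F\<close> determines the first and the last.\<close>

lemma two_level_parametric:
  assumes F: "\<And>x. F x = 1 - F (- x)" and g: "F g = 1/2 + h"
  shows "two_level S h \<in> parametric_model n F"
proof -
  have F0: "F 0 = 1/2" using F[of 0] by simp
  have Fg: "F (- g) = 1/2 - h" using F[of g] g by simp
  have "two_level S h i j = F (g * indicator S i - g * indicator S j)" for i j
    using F0 Fg g by (auto simp: two_level_def indicator_def)
  then show ?thesis
    unfolding parametric_model_def by (auto intro!: exI[of _ "\<lambda>i. g * indicator S i"])
qed

section \<open>Pairs whose comparison law depends on the selected items\<close>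

lemma finite_item_pairs: "finite (item_pairs n)"
proof -
  have "item_pairs n \<subseteq> {1..n} \<times> {1..n}" by (auto simp: item_pairs_def)
  then show ?thesis by (rule finite_subset) auto
qed

definition pairs_touching :: "nat \<Rightarrow> nat set \<Rightarrow> (nat \<times> nat) set" where
  "pairs_touching n B = {(i, j) \<in> item_pairs n. i \<in> B \<or> j \<in> B}"

text \<open>Every such pair arises by sorting the two entries of an element of
  \<open>B \<times> {1..n}\<close>.\<close>

lemma card_pairs_touching_le:
  assumes "finite B"
  shows "card (pairs_touching n B) \<le> card B * n"
proof -
  have "pairs_touching n B \<subseteq> (\<lambda>(b, j). (min b j, max b j)) ` (B \<times> {1..n})"
  proof
    fix x assume "x \<in> pairs_touching n B"
    then obtain i j where x: "x = (i, j)" "1 \<le> i" "i < j" "j \<le> n" "i \<in> B \<or> j \<in> B"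
      by (auto simp: pairs_touching_def item_pairs_def)
    then have "x = (min i j, max i j)" "x = (min j i, max j i)" by auto
    moreover have "(i, j) \<in> B \<times> {1..n} \<or> (j, i) \<in> B \<times> {1..n}" using x by auto
    ultimately show "x \<in> (\<lambda>(b, j). (min b j, max b j)) ` (B \<times> {1..n})"
      by (elim disjE rev_image_eqI) auto
  qed
  then have "card (pairs_touching n B) \<le> card (B \<times> {1..n})"
    using assms by (intro surj_card_le) auto
  then show ?thesis by (simp add: card_cartesian_product)
qed

text \<open>The hypothesis on \<open>B\<close> makes the indicator change with one sign
  \<open>c\<close> for all items. With mixed signs, an added \<open>i\<close> and a removed
  \<open>j\<close> would move the entry by \<open>2 * h\<close>.\<close>

lemma two_level_sym_diff_le:
  assumes "B \<inter> V = {} \<or> B \<subseteq> V" "0 \<le> h"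
  shows "\<bar>two_level (sym_diff V B) h i j - two_level V h i j\<bar> \<le> h"
proof -
  obtain c :: real where c: "c = 1 \<or> c = -1"
    and ind: "\<And>x. indicator (sym_diff V B) x = indicator V x + c * indicator B x"
  proof (cases "B \<subseteq> V")
    case True
    then have "indicator (sym_diff V B) x = indicator V x + (-1) * (indicator B x :: real)" for x
      by (auto split: split_indicator)
    then show ?thesis using that by blast
  next
    case False
    then have "indicator (sym_diff V B) x = indicator V x + 1 * (indicator B x :: real)" for x
      using assms by (auto split: split_indicator)
    then show ?thesis using that by blast
  qed
  have "two_level (sym_diff V B) h i j - two_level V h i j
      = h * (c * (indicator B i - indicator B j))"
    unfolding two_level_def ind by (simp add: algebra_simps)
  moreover have "\<bar>c * (indicator B i - indicator B j)\<bar> \<le> 1"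
    using c by (auto split: split_indicator)
  ultimately show ?thesis
    using assms(2) by (simp add: abs_mult mult_left_le)
qed

lemma two_level_sym_diff_eq:
  assumes "i \<notin> B" "j \<notin> B"
  shows "two_level (sym_diff V B) h i j = two_level V h i j"
  using assms by (auto simp: two_level_def indicator_def)

subsection \<open>Change of the law of the comparisons\<close>

lemma set_graph_pmf: "set_pmf (graph_pmf n p) \<subseteq> Pow (item_pairs n)"
  by (auto simp: graph_pmf_def)

lemma finite_set_graph_pmf: "finite (set_pmf (graph_pmf n p))"
  by (rule finite_subset[OF set_graph_pmf]) (simp add: finite_item_pairs)

lemma prob_estimate_pmf:
  "measure_pmf.prob (estimate_pmf n p \<rho> M) A =
     measure_pmf.expectation (graph_pmf n p)
       (\<lambda>G. expect_bits G (\<lambda>e. \<rho> (fst e) (snd e)) (\<lambda>y. measure_pmf.prob (M (G, y)) A))"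
  by (simp add: estimate_pmf_def data_pmf_def bind_assoc_pmf bind_map_pmf prob_bind_pmf case_prod_beta')

lemma set_estimate_pmf:
  assumes "set_estimator n M"
  shows "set_pmf (estimate_pmf n p \<rho> M) \<subseteq> Pow {1..n}"
proof -
  have "set_pmf (data_pmf n p \<rho>) \<subseteq> datasets n"
  proof
    fix X assume "X \<in> set_pmf (data_pmf n p \<rho>)"
    then obtain G y where X: "X = (G, y)" "G \<in> set_pmf (graph_pmf n p)"
      "y \<in> set_pmf (Pi_pmf G False (\<lambda>(i, j). bernoulli_pmf (\<rho> i j)))"
      by (auto simp: data_pmf_def)
    then have "G \<subseteq> item_pairs n" using set_graph_pmf by blast
    then have "finite G" using finite_item_pairs finite_subset by blast
    have "y \<in> {y. \<forall>e. e \<notin> G \<longrightarrow> y e = False}"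
      using X(3) set_Pi_pmf_subset[OF \<open>finite G\<close>] by (rule subsetD[rotated])
    then show "X \<in> datasets n"
      using X(1) \<open>G \<subseteq> item_pairs n\<close> by (simp add: datasets_def)
  qed
  then show ?thesis
    using assms by (fastforce simp: estimate_pmf_def set_estimator_def)
qed

lemma prob_edge:
  assumes "0 \<le> p" "p \<le> 1" "e \<in> item_pairs n"
  shows "measure_pmf.prob (graph_pmf n p) {G. e \<in> G} = p"
proof -
  let ?P = "Pi_pmf (item_pairs n) False (\<lambda>_. bernoulli_pmf p)"
  have "measure_pmf.prob (graph_pmf n p) {G. e \<in> G} = measure_pmf.prob (map_pmf (\<lambda>g. g e) ?P) {True}"
    using assms by (simp add: graph_pmf_def vimage_def)
  also have "\<dots> = p"
    using assms by (simp add: Pi_pmf_component finite_item_pairs measure_pmf_single)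
  finally show ?thesis .
qed

text \<open>Markov's inequality at twice the bound \<open>L\<close> on the mean number of compared
  pairs in \<open>K\<close>.\<close>

lemma prob_many_edges_le:
  assumes "0 \<le> p" "p \<le> 1" "K \<subseteq> item_pairs n" "real (card K) * p \<le> L" "0 < L"
  shows "measure_pmf.prob (graph_pmf n p) {G. real (card (G \<inter> K)) > 2 * L} \<le> 1 / 2"
proof -
  let ?P = "graph_pmf n p"
  have finK: "finite K" using assms finite_item_pairs finite_subset by blast
  have card_eq: "real (card (G \<inter> K)) = (\<Sum>e\<in>K. indicator {G. e \<in> G} G)" for G
    using finK by (simp add: indicator_def sum.If_cases Int_commute Int_def conj_commute)
  have "measure_pmf.prob ?P {G. real (card (G \<inter> K)) > 2 * L}
      = measure_pmf.expectation ?P (indicator {G. real (card (G \<inter> K)) > 2 * L})"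
    by simp
  also have "\<dots> \<le> measure_pmf.expectation ?P (\<lambda>G. real (card (G \<inter> K)) / (2 * L))"
    using assms by (intro expectation_mono_finite finite_set_graph_pmf) (auto split: split_indicator)
  also have "\<dots> = (\<Sum>e\<in>K. measure_pmf.prob ?P {G. e \<in> G}) / (2 * L)"
    unfolding card_eq by (simp add: integrable_measure_pmf_finite finite_set_graph_pmf)
  also have "(\<Sum>e\<in>K. measure_pmf.prob ?P {G. e \<in> G}) = real (card K) * p"
    using prob_edge[OF assms(1,2) subsetD[OF assms(3)]] by simp
  also have "real (card K) * p / (2 * L) \<le> 1 / 2"
    using assms by (simp add: field_simps)
  finally show ?thesis .
qed

text \<open>The mask turns every \<open>y\<close> into a legal data set. Privacy then gives the flip
  bound for all \<open>y\<close>, as \<open>expect_bits_private_le\<close> demands, and not just for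
  those that are \<open>False\<close> off \<open>G\<close>.\<close>

lemma expect_bits_mask:
  assumes "finite G"
  shows "expect_bits G r g = expect_bits G r (\<lambda>y. g (\<lambda>e. e \<in> G \<and> y e))"
proof (intro integral_cong_AE AE_pmfI)
  fix y assume "y \<in> set_pmf (Pi_pmf G False (\<lambda>e. bernoulli_pmf (r e)))"
  then have "(\<lambda>e. e \<in> G \<and> y e) = y"
    using set_Pi_pmf_subset[OF assms, of False] by fastforce
  then show "g y = g (\<lambda>e. e \<in> G \<and> y e)" by simp
qed auto

lemma edge_dp_flip:
  assumes "edge_dp n \<epsilon> \<delta> M" "G \<subseteq> item_pairs n" "e \<in> G"
  shows "measure_pmf.prob (M (G, \<lambda>x. x \<in> G \<and> (y(e := b)) x)) A
    \<le> exp \<epsilon> * measure_pmf.prob (M (G, \<lambda>x. x \<in> G \<and> (y(e := \<not> b)) x)) A + \<delta>"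
proof -
  have "{x \<in> G. (x \<in> G \<and> (y(e := b)) x) \<noteq> (x \<in> G \<and> (y(e := \<not> b)) x)} = {e}"
    using assms by auto
  then have "adjacent (G, \<lambda>x. x \<in> G \<and> (y(e := b)) x) (G, \<lambda>x. x \<in> G \<and> (y(e := \<not> b)) x)"
    unfolding adjacent_def by simp
  then show ?thesis
    using assms unfolding edge_dp_def by (auto simp: datasets_def)
qed

text \<open>For \<open>\<epsilon> \<le> 1\<close> the change of law is controlled by privacy; for \<open>\<epsilon> \<ge> 1\<close> the signal is so
  weak that it is controlled by the chi-square divergence whatever the estimator.\<close>

lemma conditional_change_of_law:
  fixes r r' :: "nat \<times> nat \<Rightarrow> real"
  assumes dp: "edge_dp n \<epsilon> \<delta> M" and G: "G \<subseteq> item_pairs n"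
    and r: "\<And>e. r e \<in> {1/4..3/4}" "\<And>e. r' e \<in> {0..1}"
    and rr: "\<And>e. \<bar>r' e - r e\<bar> \<le> h" "\<And>e. e \<in> G - K \<Longrightarrow> r' e = r e"
    and h: "0 \<le> h" "h \<le> 1/4" and \<epsilon>: "0 < \<epsilon>" and \<delta>: "0 \<le> \<delta>"
    and D: "real (card (G \<inter> K)) \<le> 2 * L" and L: "h * L * \<epsilon> = a"
    and small: "2 * a * \<delta> / \<epsilon> * exp (4 * a) \<le> 1/10"
  shows "expect_bits G r' (\<lambda>y. measure_pmf.prob (M (G, y)) A)
    \<le> 1/10 + 5/2 * exp (4 * a) * expect_bits G r (\<lambda>y. measure_pmf.prob (M (G, y)) A)"
proof -
  have fin: "finite G" using G finite_item_pairs finite_subset by blast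
  define D where "D = card (G \<inter> K)"
  define g where "g y = measure_pmf.prob (M (G, \<lambda>e. e \<in> G \<and> y e)) A" for y
  define \<phi> where "\<phi> = expect_bits G r g"
  define \<phi>' where "\<phi>' = expect_bits G r' g"
  have L0: "0 \<le> L" using D by (metis of_nat_0_le_iff order_trans zero_le_mult_iff zero_less_numeral not_le)
  have \<phi>: "\<phi> \<ge> 0" unfolding \<phi>_def by (intro integral_nonneg_AE) (simp add: g_def)
  have "\<phi>' \<le> 1/10 + 5/2 * exp (4 * a) * \<phi>"
  proof (cases "\<epsilon> \<le> 1")
    case True
    have "exp \<epsilon> \<le> 1 + \<epsilon> + \<epsilon>\<^sup>2" using True \<epsilon> by (intro exp_bound) auto
    also have "\<epsilon>\<^sup>2 \<le> \<epsilon>" using True \<epsilon> by (simp add: power2_eq_square mult_left_le)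
    finally have e: "exp \<epsilon> - 1 \<le> 2 * \<epsilon>" by simp
    have "(1 + h * (exp \<epsilon> - 1)) ^ D \<le> exp (h * (exp \<epsilon> - 1)) ^ D"
      using h \<epsilon> by (intro power_mono exp_ge_add_one_self) auto
    also have "\<dots> = exp (real D * (h * (exp \<epsilon> - 1)))" by (simp flip: exp_of_nat_mult)
    also have "\<dots> \<le> exp (2 * L * (h * (2 * \<epsilon>)))"
      using D e h \<epsilon> L0 by (intro iffD2[OF exp_le_cancel_iff] mult_mono) (auto simp: D_def)
    also have "2 * L * (h * (2 * \<epsilon>)) = 4 * a" by (simp flip: L)
    finally have pow: "(1 + h * (exp \<epsilon> - 1)) ^ D \<le> exp (4 * a)" .
    have "\<phi>' \<le> (1 + h * (exp \<epsilon> - 1)) ^ D * (\<phi> + real D * (h * \<delta>))"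
      unfolding \<phi>'_def \<phi>_def D_def
    proof (rule expect_bits_private_le)
      show "g (y(e := b)) \<le> exp \<epsilon> * g (y(e := \<not> b)) + \<delta>" if "e \<in> G" for y e b
        unfolding g_def by (rule edge_dp_flip[OF dp G that])
      show "r e \<in> {0..1} \<and> r' e \<in> {0..1}" for e using r(1)[of e] r(2)[of e] by auto
    qed (use fin rr h \<epsilon> \<delta> in \<open>auto simp: g_def\<close>)
    also have "\<dots> \<le> exp (4 * a) * (\<phi> + 2 * L * (h * \<delta>))"
      using pow D \<phi> h \<delta> by (intro mult_mono add_mono mult_right_mono) (auto simp: D_def)
    also have "2 * L * (h * \<delta>) = 2 * a * \<delta> / \<epsilon>"
      using \<epsilon> by (simp add: L[symmetric])
    also have "exp (4 * a) * (\<phi> + 2 * a * \<delta> / \<epsilon>) \<le> 1 * (exp (4 * a) * \<phi>) + 1/10"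
      using small by (simp add: algebra_simps)
    also have "\<dots> \<le> 5/2 * (exp (4 * a) * \<phi>) + 1/10"
      using \<phi> by (intro add_right_mono mult_right_mono) auto
    finally show ?thesis by simp
  next
    case False
    have a0: "0 \<le> a" using L0 h \<epsilon> by (simp flip: L)
    have "\<phi>'\<^sup>2 \<le> (1 + 8 * h\<^sup>2) ^ D * expect_bits G r (\<lambda>y. (g y)\<^sup>2)"
      unfolding \<phi>'_def D_def using fin r rr by (intro expect_bits_chi_square) auto
    also have "\<dots> \<le> exp (4 * a) * \<phi>"
    proof (intro mult_mono)
      have "(1 + 8 * h\<^sup>2) ^ D \<le> exp (8 * h\<^sup>2) ^ D"
        by (intro power_mono exp_ge_add_one_self) auto
      also have "\<dots> = exp (real D * (8 * h\<^sup>2))" by (simp flip: exp_of_nat_mult)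
      also have "real D * (8 * h\<^sup>2) \<le> 2 * L * (8 * h\<^sup>2)"
        using D by (intro mult_right_mono) (auto simp: D_def)
      \<comment> \<open>The exponent is quadratic in \<open>h\<close>: one factor
        \<open>h * L\<close> is at most \<open>a\<close> because \<epsilon> \<ge> 1, and the
        remaining \<open>16 * h\<close> is at most 4.\<close>
      also have "2 * L * (8 * h\<^sup>2) = 16 * h * (h * L * 1)" by (simp add: power2_eq_square)
      also have "\<dots> \<le> 16 * h * (h * L * \<epsilon>)"
        using False h L0 by (intro mult_left_mono) auto
      also have "\<dots> \<le> 16 * (1/4) * a"
        unfolding L using h a0 by (intro mult_right_mono) auto
      finally show "(1 + 8 * h\<^sup>2) ^ D \<le> exp (4 * a)" by simp
      show "expect_bits G r (\<lambda>y. (g y)\<^sup>2) \<le> \<phi>"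
        unfolding \<phi>_def using fin
        by (intro expect_bits_mono) (auto simp: g_def power2_eq_square mult_left_le)
      show "0 \<le> expect_bits G r (\<lambda>y. (g y)\<^sup>2)" by (intro integral_nonneg_AE) simp
    qed auto
    finally have sq: "\<phi>'\<^sup>2 \<le> exp (4 * a) * \<phi>" .
    \<comment> \<open>Expanding this square linearises the quadratic bound: an additive 1/10 and the
      factor 5/2 give the same affine form as in the private case.\<close>
    have "0 \<le> (\<phi>' - 1/5)\<^sup>2" by simp
    then have "\<phi>' \<le> 1/10 + 5/2 * \<phi>'\<^sup>2" by (simp add: power2_eq_square algebra_simps)
    with sq show ?thesis by simp
  qed
  then show ?thesis
    unfolding \<phi>_def \<phi>'_def g_def using fin
    by (simp flip: expect_bits_mask[of G _ "\<lambda>y. measure_pmf.prob (M (G, y)) A"])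
qed

text \<open>The conditional bound is averaged over the graph. Graphs with more than twice
  \<open>s * n * p\<close> compared pairs touching \<open>B\<close> are given up, which costs 1/2;
  together with the conditional 1/10 this is 3/5, still below 9/10.\<close>

lemma change_of_law:
  assumes dp: "edge_dp n \<epsilon> \<delta> M" and p: "0 < p" "p \<le> 1" and n: "n > 0"
    and h: "0 \<le> h" "h \<le> 1/4" and \<epsilon>: "0 < \<epsilon>" and \<delta>: "0 \<le> \<delta>"
    and B: "finite B" "card B = s" "s \<ge> 1" "B \<inter> V = {} \<or> B \<subseteq> V"
    and L: "h * (real s * real n * p) * \<epsilon> = a"
    and small: "2 * a * \<delta> / \<epsilon> * exp (4 * a) \<le> 1/10"
  shows "measure_pmf.prob (estimate_pmf n p (two_level (sym_diff V B) h) M) A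
    \<le> 3/5 + 5/2 * exp (4 * a) * measure_pmf.prob (estimate_pmf n p (two_level V h) M) A"
proof -
  let ?P = "graph_pmf n p" and ?K = "pairs_touching n B"
  define L where "L = real s * real n * p"
  define \<phi> where "\<phi> S G = expect_bits G (\<lambda>e. two_level S h (fst e) (snd e))
    (\<lambda>y. measure_pmf.prob (M (G, y)) A)" for S G
  define bad where "bad = {G. real (card (G \<inter> ?K)) > 2 * L}"
  have "real (card ?K) * p \<le> L"
    using card_pairs_touching_le[OF B(1), of n] p B(2)
    unfolding L_def by (intro mult_right_mono) (simp_all flip: of_nat_mult)
  moreover have "L > 0" using p n B by (simp add: L_def)
  moreover have "?K \<subseteq> item_pairs n" by (auto simp: pairs_touching_def)
  ultimately have bad: "measure_pmf.prob ?P bad \<le> 1/2"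
    unfolding bad_def using p by (intro prob_many_edges_le) auto
  have \<phi>01: "0 \<le> \<phi> S G" "\<phi> S G \<le> 1" for S G
    unfolding \<phi>_def by (auto intro!: integral_nonneg_AE measure_pmf.integral_le_const measure_pmf.integrable_const_bound[where B = 1])
  have mem: "two_level S h i j \<in> {1/4..3/4}" for S i j using two_level_mem h by blast
  have pt: "\<phi> (sym_diff V B) G \<le> indicator bad G + 1/10 + 5/2 * exp (4 * a) * \<phi> V G"
    if G: "G \<in> set_pmf ?P" for G
  proof (cases "G \<in> bad")
    case True
    have "0 \<le> 5/2 * exp (4 * a) * \<phi> V G" using \<phi>01(1) by simp
    moreover have "\<phi> (sym_diff V B) G \<le> 1" by (rule \<phi>01)
    moreover have "indicator bad G = (1 :: real)" using True by simp
    ultimately show ?thesis by linarith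
  next
    case False
    have "\<phi> (sym_diff V B) G \<le> 1/10 + 5/2 * exp (4 * a) * \<phi> V G"
      unfolding \<phi>_def
    proof (rule conditional_change_of_law[OF dp, where L = L and h = h and K = ?K])
      show Gs: "G \<subseteq> item_pairs n" using G set_graph_pmf by blast
      show "two_level V h (fst e) (snd e) \<in> {1/4..3/4}" for e :: "nat \<times> nat" by (rule mem)
      show "two_level (sym_diff V B) h (fst e) (snd e) \<in> {0..1}" for e :: "nat \<times> nat"
        using mem[of "sym_diff V B" "fst e" "snd e"] by auto
      show "\<bar>two_level (sym_diff V B) h (fst e) (snd e) - two_level V h (fst e) (snd e)\<bar> \<le> h"
        for e :: "nat \<times> nat"
        by (rule two_level_sym_diff_le[OF B(4) h(1)])
      show "two_level (sym_diff V B) h (fst e) (snd e) = two_level V h (fst e) (snd e)"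
        if "e \<in> G - ?K" for e
        using that Gs by (intro two_level_sym_diff_eq) (auto simp: pairs_touching_def)
      show "real (card (G \<inter> ?K)) \<le> 2 * L" using False by (simp add: bad_def)
    qed (use h \<epsilon> \<delta> small L in \<open>auto simp: L_def\<close>)
    then show ?thesis using False by simp
  qed
  have "measure_pmf.expectation ?P (\<phi> (sym_diff V B))
      \<le> measure_pmf.expectation ?P (\<lambda>G. indicator bad G + 1/10 + 5/2 * exp (4 * a) * \<phi> V G)"
    using pt by (intro expectation_mono_finite finite_set_graph_pmf)
  also have "\<dots> = measure_pmf.prob ?P bad + 1/10
      + 5/2 * exp (4 * a) * measure_pmf.expectation ?P (\<phi> V)"
    by (simp add: integrable_measure_pmf_finite finite_set_graph_pmf)
  also have "\<dots> \<le> 3/5 + 5/2 * exp (4 * a) * measure_pmf.expectation ?P (\<phi> V)"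
    using bad by simp
  finally show ?thesis
    unfolding prob_estimate_pmf \<phi>_def .
qed

text \<open>Double counting: the sum is the mean number of events that contain the outcome.\<close>

lemma sum_prob_le:
  assumes "finite I" "\<And>x. card {i \<in> I. x \<in> A i} \<le> C"
  shows "(\<Sum>i\<in>I. measure_pmf.prob P (A i)) \<le> real C"
proof -
  have int: "integrable P (indicator (A i) :: _ \<Rightarrow> real)" for i
    by (intro measure_pmf.integrable_const_bound[where B = 1]) auto
  have "(\<Sum>i\<in>I. measure_pmf.prob P (A i)) = measure_pmf.expectation P (\<lambda>x. \<Sum>i\<in>I. indicator (A i) x)"
    using int by simp
  also have "\<dots> = measure_pmf.expectation P (\<lambda>x. real (card {i \<in> I. x \<in> A i}))"
    using assms(1) by (simp add: indicator_def sum.If_cases Int_def)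
  also have "\<dots> \<le> real C"
    using assms by (intro measure_pmf.integral_le_const measure_pmf.integrable_const_bound[where B = "real C"]) auto
  finally show ?thesis .
qed

subsection \<open>The lower bound\<close>

lemma obtain_block_number:
  fixes \<nu> :: real and m k l :: nat
  assumes \<nu>: "0 < \<nu>" "\<nu> < 1" and kl: "m + 1 \<le> k" "m + 1 \<le> l"
    and m: "real (2 * m) * (1 + \<nu>) \<le> min (real k) (real l)"
  obtains s where "2 * m < s" "s \<le> 4 * m + 1" "s \<le> k" "s \<le> l" "\<nu> * real s \<le> 3 * real (s - 2 * m)"
proof
  \<comment> \<open>The number of blocks is \<open>s = 2 * m + t\<close>: the surplus
    \<open>t\<close> is about \<open>2 * m * \<nu>\<close>, as much as \<open>k\<close> and
    \<open>l\<close> allow, and the maximum with 1 keeps it positive when the floor vanishes, for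
    instance at \<open>m = 0\<close>. From \<lfloor>2m\<nu>\<rfloor> + 1 \<le> 2t and \<nu>t \<le> t
    comes the factor 3.\<close>
  define t where "t = max 1 (nat \<lfloor>2 * real m * \<nu>\<rfloor>)"
  have fl: "real (nat \<lfloor>2 * real m * \<nu>\<rfloor>) \<le> 2 * real m * \<nu>" using \<nu> by simp
  also have "\<dots> \<le> 2 * real m" using \<nu> by (simp add: mult_left_le)
  finally have t2m: "nat \<lfloor>2 * real m * \<nu>\<rfloor> \<le> 2 * m" by linarith
  show "2 * m < 2 * m + t" by (simp add: t_def)
  show "2 * m + t \<le> 4 * m + 1" using t2m by (simp add: t_def)
  have up: "2 * m + t \<le> x" if x: "m + 1 \<le> x" "real (2 * m) * (1 + \<nu>) \<le> real x" for x
  proof -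
    have "2 * m + nat \<lfloor>2 * real m * \<nu>\<rfloor> \<le> x"
      using x(2) fl by (simp add: algebra_simps flip: of_nat_le_iff[where 'a = real])
    moreover have "2 * m + 1 \<le> x"
    proof (cases "m = 0")
      case False
      then have "real (2 * m) < real (2 * m) * (1 + \<nu>)" using \<nu> by simp
      then show ?thesis using x(2) by linarith
    qed (use x in simp)
    ultimately show ?thesis by (simp add: t_def)
  qed
  show "2 * m + t \<le> k" "2 * m + t \<le> l" using up kl m by auto
  have "2 * real m * \<nu> \<le> 2 * real t"
  proof -
    have "2 * real m * \<nu> \<le> real (nat \<lfloor>2 * real m * \<nu>\<rfloor>) + 1" by linarith
    then show ?thesis by (simp add: t_def)
  qed
  moreover have "\<nu> * real t \<le> real t" using \<nu> by (simp add: mult_left_le_one_le)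
  ultimately show "\<nu> * real (2 * m + t) \<le> 3 * real (2 * m + t - 2 * m)"
    by (simp add: algebra_simps)
qed

text \<open>With Z = n powr (\<nu>/2) and Y = n powr (1 - \<nu>) one has n = Z * Z * Y and s \<le> 3
  * Y. So n / (2 * s) is at least Z * Z / 6 \<ge> 2 * Z, and rounding down costs at most 1.\<close>

lemma block_length_ge:
  fixes n s m :: nat
  assumes "real (2 * m) \<le> real n powr (1 - \<nu>)" "s \<le> 4 * m + 1" "1 \<le> s" "0 < \<nu>" "\<nu> < 1"
    and Z: "real n powr (\<nu> / 2) \<ge> 12" and n: "n > 0"
  shows "real n powr (\<nu> / 2) \<le> real (n div (2 * s))"
proof -
  define Z where "Z = real n powr (\<nu> / 2)"
  define Y where "Y = real n powr (1 - \<nu>)"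
  have Y: "Y \<ge> 1" using n assms by (simp add: Y_def ge_one_powr_ge_zero)
  have nn: "real n = Z * Z * Y"
    using n by (simp add: Z_def Y_def flip: powr_add)
  have s3: "real s \<le> 3 * Y"
    using assms(1,2) Y by (simp add: Y_def)
  have "real n / (2 * real s) - 1 \<le> real (n div (2 * s))"
  proof -
    have "real n / real (2 * s) - 1 \<le> real (n div (2 * s))"
      using floor_divide_of_nat_eq[of n "2 * s", where 'a = real] by linarith
    then show ?thesis by simp
  qed
  moreover have "Z * Z / 6 \<le> real n / (2 * real s)"
  proof -
    have "Z * Z * (2 * real s) \<le> Z * Z * (6 * Y)" using s3 by (intro mult_left_mono) auto
    then show ?thesis using assms(3) nn by (simp add: field_simps)
  qed
  moreover have "12 * Z \<le> Z * Z" using Z by (intro mult_right_mono) (auto simp: Z_def)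
  ultimately show ?thesis using Z unfolding Z_def[symmetric] by linarith
qed

text \<open>Since 4/48 = 1/12, the exponential is \<open>X ^ s\<close> with X = n powr (\<nu>1 *
  \<nu>2 / 12). For X \<ge> 50 the factors 25 and \<open>2 ^ s\<close> are absorbed into
  \<open>(X * X) ^ s\<close>, a power of n with exponent \<nu>1 * \<nu>2 * s / 6, which
  \<open>s - 2 * m\<close> surplus blocks of length \<open>q\<close> outweigh.\<close>

lemma packing_beats_likelihood:
  fixes n s m q :: nat
  assumes \<nu>: "0 < \<nu>1" "0 < \<nu>2" and n: "n > 0" and X: "real n powr (\<nu>1 * \<nu>2 / 12) \<ge> 50"
    and s: "2 * m < s" "\<nu>2 * real s \<le> 3 * real (s - 2 * m)"
    and q: "real n powr (\<nu>1 / 2) \<le> real q"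
  shows "25 * exp (4 * (\<nu>1 * \<nu>2 / 48 * real s * ln (real n))) * (2 ^ s * real q ^ (2 * m)) \<le> real q ^ s"
proof -
  define X where "X = real n powr (\<nu>1 * \<nu>2 / 12)"
  have X50: "X \<ge> 50" using X by (simp add: X_def)
  have "exp (4 * (\<nu>1 * \<nu>2 / 48 * real s * ln (real n))) = X ^ s"
    using n by (simp add: X_def powr_def flip: exp_of_nat_mult)
  moreover have "25 * (X ^ s * 2 ^ s) \<le> real q ^ (s - 2 * m)"
  proof -
    have "(25::real) \<le> 25 ^ s" using s by (intro self_le_power) auto
    then have "25 * (X ^ s * 2 ^ s) \<le> 25 ^ s * (X ^ s * 2 ^ s)"
      using X50 by (intro mult_right_mono) auto
    also have "\<dots> = (25 * (X * 2)) ^ s" by (simp only: power_mult_distrib)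
    also have "\<dots> = (50 * X) ^ s" by simp
    also have "\<dots> \<le> (X * X) ^ s" using X50 by (intro power_mono mult_right_mono) auto
    also have "\<dots> = real n powr (\<nu>1 / 2 * (\<nu>2 * real s / 3))"
    proof -
      have "X * X = real n powr (\<nu>1 * \<nu>2 / 6)" by (simp add: X_def flip: powr_add)
      then have "(X * X) ^ s = (real n powr (\<nu>1 * \<nu>2 / 6)) powr real s"
        using n by (simp add: powr_realpow)
      then show ?thesis by (simp add: powr_powr ac_simps)
    qed
    also have "\<dots> \<le> real n powr (\<nu>1 / 2 * real (s - 2 * m))"
      using n s \<nu> by (intro powr_mono mult_left_mono) auto
    also have "\<dots> = (real n powr (\<nu>1 / 2)) ^ (s - 2 * m)"
      using n by (simp add: powr_powr flip: powr_realpow)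
    also have "\<dots> \<le> real q ^ (s - 2 * m)" using q by (intro power_mono) auto
    finally show ?thesis .
  qed
  then have "25 * (X ^ s * 2 ^ s) * real q ^ (2 * m) \<le> real q ^ (s - 2 * m) * real q ^ (2 * m)"
    by (intro mult_right_mono) auto
  moreover have "real q ^ (s - 2 * m) * real q ^ (2 * m) = real q ^ s"
    using s by (simp flip: power_add)
  ultimately show ?thesis by (simp add: ac_simps)
qed

text \<open>With M = max m 1 one has s \<le> 5 * M, so \<open>c1 \<le> 1/48\<close> bounds the
  exponential by \<open>n ^ M\<close>. The bound on \<delta> supplies \<open>n ^ (10 * M)\<close> in
  the denominator and cancels the prefactor M * ln n / \<epsilon>.\<close>

lemma privacy_slack_small:
  fixes n m s :: nat
  assumes c1: "0 < c1" "c1 \<le> 1/48" and c0: "0 < c0" "c0 \<le> 1/2" and n: "n \<ge> 50" and \<epsilon>: "\<epsilon> > 0"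
    and s: "s \<le> 4 * m + 1" and "0 \<le> \<delta>"
    and \<delta>: "\<delta> < c0 * inverse (real (max m 1) * ln (real n) * real n ^ (10 * max m 1) / \<epsilon>)"
  shows "2 * (c1 * real s * ln (real n)) * \<delta> / \<epsilon> * exp (4 * (c1 * real s * ln (real n))) \<le> 1/10"
proof -
  define M where "M = max m 1"
  define l where "l = ln (real n)"
  have l: "l > 0" using n by (simp add: l_def)
  have M: "M \<ge> 1" by (simp add: M_def)
  have sM: "real s \<le> 5 * real M" using s by (simp add: M_def)
  have \<delta>': "\<delta> / \<epsilon> \<le> c0 / (real M * l * real n ^ (10 * M))"
    using \<delta> \<epsilon> by (simp add: M_def l_def field_simps)
  have "2 * (c1 * real s * l) * (\<delta> / \<epsilon>) \<le> 2 * (1/48 * (5 * real M) * l) * (1/2 / (real M * l * real n ^ (10 * M)))"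
  proof (intro mult_mono mult_nonneg_nonneg)
    have "c0 / (real M * l * real n ^ (10 * M)) \<le> 1/2 / (real M * l * real n ^ (10 * M))"
      using c0 l M n by (intro divide_right_mono) auto
    with \<delta>' show "\<delta> / \<epsilon> \<le> 1/2 / (real M * l * real n ^ (10 * M))" by linarith
  qed (use c1 sM l assms in auto)
  also have "\<dots> = 5/48 / real n ^ (10 * M)" using l M by (simp add: field_simps)
  finally have 1: "2 * (c1 * real s * l) * (\<delta> / \<epsilon>) \<le> 5/48 / real n ^ (10 * M)" .
  have "4 * (c1 * real s * l) \<le> 4 * (1/48 * (5 * real M) * l)"
    using c1 sM l by (intro mult_left_mono mult_right_mono mult_mono) auto
  also have "\<dots> \<le> real M * l" using l M by simp
  finally have "exp (4 * (c1 * real s * l)) \<le> exp (real M * l)" by simp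
  also have "\<dots> = real n ^ M" using n by (simp add: l_def exp_of_nat_mult)
  finally have 2: "exp (4 * (c1 * real s * l)) \<le> real n ^ M" .
  have "2 * (c1 * real s * l) * (\<delta> / \<epsilon>) * exp (4 * (c1 * real s * l)) \<le> 5/48 / real n ^ (10 * M) * real n ^ M"
    using 1 2 n by (intro mult_mono) auto
  also have "\<dots> \<le> 5/48 / real n ^ (10 * M) * (real n ^ (10 * M) / 50)"
  proof -
    have "real n ^ M * 50 \<le> real n ^ M * real n" using n by (intro mult_left_mono) auto
    also have "\<dots> = real n ^ (M + 1)" by simp
    also have "\<dots> \<le> real n ^ (10 * M)" using n M by (intro power_increasing) auto
    finally show ?thesis by (intro mult_left_mono) auto
  qed
  also have "\<dots> = 1/480" using n by simp
  finally have "2 * (c1 * real s * l) * (\<delta> / \<epsilon>) * exp (4 * (c1 * real s * l)) \<le> 1/10" by simp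
  then show ?thesis by (simp add: l_def)
qed

section \<open>Averaging over the planted sets\<close>

lemma two_level_lower_bound:
  assumes \<nu>: "0 < \<nu>1" "\<nu>1 < 1" "0 < \<nu>2" "\<nu>2 < 1"
    and adm: "admissible \<nu>1 \<nu>2 c0 n p k m \<epsilon> \<delta>" and c0: "0 < c0" "c0 \<le> 1/2"
    and X: "real n powr (\<nu>1 * \<nu>2 / 12) \<ge> 50" and n0: "n > 0"
    and est: "set_estimator n M" and dp: "edge_dp n \<epsilon> \<delta> M"
    and h_def: "h = \<nu>1 * \<nu>2 / 48 * (ln (real n) / (real n * p * \<epsilon>))"
  shows "\<exists>S \<subseteq> {1..n}. card S = k \<and>
    1/10 \<le> measure_pmf.prob (estimate_pmf n p (two_level S h) M) {S'. hamming_dist S' S > 2 * m}"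
proof -
  define c1 where "c1 = \<nu>1 * \<nu>2 / 48"
  have \<nu>\<nu>: "0 < \<nu>1 * \<nu>2" "\<nu>1 * \<nu>2 \<le> \<nu>1" "\<nu>1 * \<nu>2 \<le> 1"
    using \<nu> by (auto simp: mult_left_le mult_le_one)
  have c1: "0 < c1" "c1 \<le> 1/48" using \<nu>\<nu> by (auto simp: c1_def)
  have n1: "real n \<ge> 1" using n0 by simp
  have n50: "n \<ge> 50"
  proof -
    have "real n powr (\<nu>1 * \<nu>2 / 12) \<le> real n powr 1" using \<nu>\<nu> n1 by (intro powr_mono) auto
    then show ?thesis using X n0 by simp
  qed
  have Z: "real n powr (\<nu>1 / 2) \<ge> 50"
  proof -
    have "real n powr (\<nu>1 * \<nu>2 / 12) \<le> real n powr (\<nu>1 / 2)" using \<nu> \<nu>\<nu>(2) n1 by (intro powr_mono) auto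
    then show ?thesis using X by simp
  qed
  have par: "0 < p" "p \<le> 1" "0 < \<epsilon>" "0 \<le> \<delta>" "1 \<le> k" "k \<le> n - 1" "m \<le> k - 1" "m \<le> n - k - 1"
    and m: "real (2 * m) \<le> inverse (1 + \<nu>2) * min (real n powr (1 - \<nu>1)) (min (real k) (real (n - k)))"
    and r: "ln (real n) / (real n * p * \<epsilon>) < c0"
    and \<delta>: "\<delta> < c0 * inverse (real (max m 1) * ln (real n) * real n ^ (10 * max m 1) / \<epsilon>)"
    using adm by (auto simp: admissible_def)
  have m': "real (2 * m) * (1 + \<nu>2) \<le> min (real n powr (1 - \<nu>1)) (min (real k) (real (n - k)))"
    using m \<nu> by (simp add: field_simps)
  have km: "m + 1 \<le> k" "m + 1 \<le> n - k" using par n50 by linarith+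
  have mk: "real (2 * m) * (1 + \<nu>2) \<le> min (real k) (real (n - k))" using m' by simp
  obtain s where s: "2 * m < s" "s \<le> 4 * m + 1" "s \<le> k" "s \<le> n - k"
      "\<nu>2 * real s \<le> 3 * real (s - 2 * m)"
    by (rule obtain_block_number[OF \<nu>(3,4) km mk])
  define q where "q = n div (2 * s)"
  have "real (2 * m) * 1 \<le> real (2 * m) * (1 + \<nu>2)" using \<nu> by (intro mult_left_mono) auto
  then have q: "real n powr (\<nu>1 / 2) \<le> real q"
    unfolding q_def using m' s \<nu> Z n0 by (intro block_length_ge[where m = m]) auto
  have q1: "q \<ge> 1" using q Z by linarith
  have sq: "2 * (s * q) \<le> n"
    unfolding q_def by (metis mult.assoc mult.commute times_div_less_eq_dividend)
  have lnpos: "0 < ln (real n) / (real n * p * \<epsilon>)" using n50 par by simp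
  have h: "0 < h" "h \<le> 1/4"
  proof -
    show "0 < h" unfolding h_def c1_def[symmetric] using c1(1) lnpos by (rule mult_pos_pos)
    have half: "ln (real n) / (real n * p * \<epsilon>) \<le> 1/2" using r c0 by linarith
    have "h \<le> 1/48 * (1/2)"
      unfolding h_def c1_def[symmetric] using lnpos by (intro mult_mono c1(2) half) simp_all
    then show "h \<le> 1/4" by simp
  qed
  define a where "a = c1 * real s * ln (real n)"
  have a: "h * (real s * real n * p) * \<epsilon> = a"
    using par n0 by (simp add: h_def a_def c1_def)
  have small: "2 * a * \<delta> / \<epsilon> * exp (4 * a) \<le> 1/10"
    unfolding a_def by (rule privacy_slack_small[OF c1 c0 n50 par(3) s(2) par(4) \<delta>])
  \<comment> \<open>All blocks lie in {1..s * q}, within the first half of the items. For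
    \<open>2 * k \<le> n\<close> the last \<open>k - s\<close> items avoid them; otherwise the first
    \<open>k + s\<close> items contain them. \<open>V\<close> itself does not have \<open>k\<close>
    elements: its matrix only serves as a common reference law.\<close>
  define V where "V = (if 2 * k \<le> n then {n - (k - s) + 1..n} else {1..k + s})"
  define B where "B f = block_set s q f" for f
  define S where "S f = sym_diff V (B f)" for f
  define \<F> where "\<F> = choices s q"
  have finF: "finite \<F>" unfolding \<F>_def by (intro finite_PiE) auto
  have cardF: "card \<F> = q ^ s" by (simp add: \<F>_def card_PiE)
  have Bp: "finite (B f)" "card (B f) = s" "B f \<subseteq> {1..s * q}" if "f \<in> \<F>" for f
    using that block_set_subset card_block_set by (auto simp: B_def \<F>_def block_set_def)
  have geom: "S f \<subseteq> {1..n} \<and> card (S f) = k \<and> (B f \<inter> V = {} \<or> B f \<subseteq> V)" if f: "f \<in> \<F>" for f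
  proof (cases "2 * k \<le> n")
    case True
    then have V: "V = {n - (k - s) + 1..n}" by (simp add: V_def)
    have "B f \<subseteq> {1..n - (k - s)}" using Bp(3)[OF f] sq True s by fastforce
    then have "B f \<inter> V = {}" "B f \<subseteq> {1..n}" by (fastforce simp: V)+
    moreover have "V \<subseteq> {1..n}" "finite V" "card V = k - s" using par by (auto simp: V)
    moreover from calculation have "S f = V \<union> B f" by (auto simp: S_def)
    ultimately show ?thesis
      using Bp[OF f] s by (simp add: card_Un_disjoint Int_commute)
  next
    case False
    then have V: "V = {1..k + s}" by (simp add: V_def)
    have "B f \<subseteq> V" using Bp(3)[OF f] sq False by (fastforce simp: V)
    moreover from calculation have "S f = V - B f" by (auto simp: S_def)
    moreover have "V \<subseteq> {1..n}" "card V = k + s" using s par by (auto simp: V)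
    ultimately show ?thesis
      using Bp[OF f] by (auto simp: card_Diff_subset)
  qed
  \<comment> \<open>Restricted to subsets of {1..n} because \<open>card\<close> is 0 on infinite
    sets: an infinite \<open>T\<close> would be at distance 0 from every \<open>S f\<close>. The
    estimator's outputs are such subsets almost surely.\<close>
  define near where "near f = {T \<in> Pow {1..n}. hamming_dist T (S f) \<le> 2 * m}" for f
  let ?P = "\<lambda>f. estimate_pmf n p (two_level (S f) h) M"
  let ?Q = "estimate_pmf n p (two_level V h) M"
  have "card {f \<in> \<F>. T \<in> near f} \<le> 2 ^ s * q ^ (2 * m)" for T
  proof (cases "T \<subseteq> {1..n}")
    case True
    then have "finite T" using finite_subset by blast
    \<comment> \<open>Symmetric difference is associative, so \<open>V\<close> can be moved over to
      \<open>T\<close> and the count of nearby choices applies to the shifted set.\<close>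
    have sd: "hamming_dist T (S f) = card (sym_diff (sym_diff T V) (block_set s q f))" for f
      unfolding hamming_dist_def S_def B_def by (rule arg_cong[where f = card]) auto
    have "{f \<in> \<F>. T \<in> near f} \<subseteq> {f \<in> choices s q. card (sym_diff (sym_diff T V) (block_set s q f)) \<le> 2 * m}"
    proof
      fix f assume "f \<in> {f \<in> \<F>. T \<in> near f}"
      then have "f \<in> choices s q" "hamming_dist T (S f) \<le> 2 * m" by (simp_all add: near_def \<F>_def)
      then show "f \<in> {f \<in> choices s q. card (sym_diff (sym_diff T V) (block_set s q f)) \<le> 2 * m}"
        unfolding sd by blast
    qed
    then have "card {f \<in> \<F>. T \<in> near f} \<le> card {f \<in> choices s q. card (sym_diff (sym_diff T V) (block_set s q f)) \<le> 2 * m}"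
      by (intro card_mono) (auto intro!: finite_PiE)
    also have "\<dots> \<le> 2 ^ s * q ^ (2 * m)"
      using \<open>finite T\<close> q1 by (intro card_choices_near_le) (auto simp: V_def)
    finally show ?thesis .
  qed (simp add: near_def)
  then have sumQ: "(\<Sum>f\<in>\<F>. measure_pmf.prob ?Q (near f)) \<le> real (2 ^ s * q ^ (2 * m))"
    by (intro sum_prob_le finF)
  have "\<exists>f\<in>\<F>. measure_pmf.prob (?P f) (near f) \<le> 9/10"
  proof (rule ccontr)
    assume neg: "\<not> ?thesis"
    have "real (q ^ s) * (9/10) = (\<Sum>f\<in>\<F>. 9/10)" by (simp add: cardF)
    also have "\<dots> < (\<Sum>f\<in>\<F>. measure_pmf.prob (?P f) (near f))"
    proof (rule sum_strict_mono)
      show "\<F> \<noteq> {}" using cardF q1 by auto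
    qed (use neg finF in \<open>auto simp: not_le\<close>)
    also have "\<dots> \<le> (\<Sum>f\<in>\<F>. 3/5 + 5/2 * exp (4 * a) * measure_pmf.prob ?Q (near f))"
    proof (rule sum_mono)
      fix f assume f: "f \<in> \<F>"
      show "measure_pmf.prob (?P f) (near f) \<le> 3/5 + 5/2 * exp (4 * a) * measure_pmf.prob ?Q (near f)"
        unfolding S_def using par n0 h Bp[OF f] geom[OF f] s a small
        by (intro change_of_law[OF dp, where s = s]) auto
    qed
    also have "\<dots> = real (q ^ s) * (3/5) + 5/2 * exp (4 * a) * (\<Sum>f\<in>\<F>. measure_pmf.prob ?Q (near f))"
      by (simp add: sum.distrib cardF sum_distrib_left)
    also have "\<dots> \<le> real (q ^ s) * (3/5) + 5/2 * exp (4 * a) * real (2 ^ s * q ^ (2 * m))"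
      using sumQ by (intro add_left_mono mult_left_mono) auto
    \<comment> \<open>Ten times the previous inequality: 9 - 6 = 3 on the left, 10 * 5/2 = 25 on the
      right.\<close>
    finally have "real q ^ s * 3 < 25 * exp (4 * a) * (2 ^ s * real q ^ (2 * m))"
      by (simp add: ac_simps)
    moreover have "25 * exp (4 * a) * (2 ^ s * real q ^ (2 * m)) \<le> real q ^ s"
      unfolding a_def c1_def using \<nu> n0 X s q by (intro packing_beats_likelihood) auto
    moreover have "real q ^ s > 0" using q1 by simp
    ultimately show False by linarith
  qed
  then obtain f where f: "f \<in> \<F>" "measure_pmf.prob (?P f) (near f) \<le> 9/10" by blast
  have "1 - measure_pmf.prob (?P f) (near f) = measure_pmf.prob (?P f) (- near f)"
    using measure_pmf.prob_compl[of "near f" "?P f"] by (simp add: Compl_eq_Diff_UNIV)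
  also have "\<dots> \<le> measure_pmf.prob (?P f) {T. hamming_dist T (S f) > 2 * m}"
    using set_estimate_pmf[OF est, of p "two_level (S f) h"]
    by (intro measure_pmf.finite_measure_mono_AE) (auto simp: AE_measure_pmf_iff near_def)
  finally have "1/10 \<le> measure_pmf.prob (?P f) {T. hamming_dist T (S f) > 2 * m}" using f by simp
  then show ?thesis using geom[OF f(1)] by blast
qed

text \<open>\<open>R\<close> stands for all matrices or for the parametric model. Here
  \<open>c0\<close> has a second role: \<open>h\<close> is at most ln n / (n * p * \<epsilon>) < c0,
  so bounding the latter keeps the signal where the two-level matrices belong to
  \<open>R\<close>.\<close>

lemma SUP_lower_bound:
  assumes \<nu>: "0 < \<nu>1" "\<nu>1 < 1" "0 < \<nu>2" "\<nu>2 < 1"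
    and adm: "admissible \<nu>1 \<nu>2 c0 n p k m \<epsilon> \<delta>" and c0: "0 < c0" "c0 \<le> 1/2"
    and n: "real n \<ge> 50 powr (12 / (\<nu>1 * \<nu>2))"
    and c: "c < \<nu>1 * \<nu>2 / 48" and rule: "top_k_rule n k Sk"
    and est: "set_estimator n M" and dp: "edge_dp n \<epsilon> \<delta> M"
    and R: "\<And>S h. 0 < h \<Longrightarrow> h \<le> c0 \<Longrightarrow> two_level S h \<in> R"
  shows "(SUP \<rho> \<in> Theta_tilde n p \<epsilon> k m c \<inter> R.
      ennreal (measure_pmf.prob (estimate_pmf n p \<rho> M) {S. hamming_dist S (Sk \<rho>) > 2 * m})) \<ge> ennreal (1/10)"
proof -
  have "(0::real) < 50 powr (12 / (\<nu>1 * \<nu>2))" by simp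
  then have n0: "n > 0" using n by (cases n) auto
  have "(50 powr (12 / (\<nu>1 * \<nu>2))) powr (\<nu>1 * \<nu>2 / 12) \<le> real n powr (\<nu>1 * \<nu>2 / 12)"
    using n \<nu> by (intro powr_mono2) auto
  then have X: "real n powr (\<nu>1 * \<nu>2 / 12) \<ge> 50" using \<nu> by (simp add: powr_powr)
  then have n2: "n \<noteq> 1" by auto
  define g where "g = ln (real n) / (real n * p * \<epsilon>)"
  define h where "h = \<nu>1 * \<nu>2 / 48 * g"
  have par: "0 < p" "0 < \<epsilon>" "1 \<le> k" "k < n" "m \<le> k - 1" "m \<le> n - k - 1" "g < c0"
    using adm n0 by (auto simp: admissible_def g_def)
  have g: "0 < g" using n0 n2 par by (simp add: g_def)
  have \<nu>\<nu>: "0 < \<nu>1 * \<nu>2" "\<nu>1 * \<nu>2 \<le> 1" using \<nu> by (auto simp: mult_le_one)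
  have h: "0 < h" "h \<le> g" using g \<nu>\<nu> by (auto simp: h_def mult_left_le_one_le)
  have "h \<le> 1/48 * (1/2)" unfolding h_def using g \<nu>\<nu> par c0 by (intro mult_mono) auto
  then have h4: "h \<le> 1/4" by simp
  obtain S where S: "S \<subseteq> {1..n}" "card S = k"
    "1/10 \<le> measure_pmf.prob (estimate_pmf n p (two_level S h) M) {S'. hamming_dist S' S > 2 * m}"
    using two_level_lower_bound[OF \<nu> adm c0 X n0 est dp h_def[unfolded g_def]] by blast
  have Sk: "Sk (two_level S h) = S" using top_k_two_level[OF rule S(1,2) h(1) h4 n0] .
  have "c * g \<le> h" unfolding h_def using c g by (intro mult_right_mono) auto
  then have "two_level S h \<in> Theta_tilde n p \<epsilon> k m c"
    using S h h4 par by (intro two_level_Theta) (auto simp: g_def)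
  moreover have "two_level S h \<in> R" using R h par by simp
  ultimately have "ennreal (measure_pmf.prob (estimate_pmf n p (two_level S h) M)
      {S'. hamming_dist S' (Sk (two_level S h)) > 2 * m}) \<le> (SUP \<rho> \<in> Theta_tilde n p \<epsilon> k m c \<inter> R.
      ennreal (measure_pmf.prob (estimate_pmf n p \<rho> M) {S. hamming_dist S (Sk \<rho>) > 2 * m}))"
    by (intro SUP_upper) auto
  moreover have "ennreal (1/10) \<le> ennreal (measure_pmf.prob (estimate_pmf n p (two_level S h) M)
      {S'. hamming_dist S' (Sk (two_level S h)) > 2 * m})"
    unfolding Sk using S(3) by (rule ennreal_leI)
  ultimately show ?thesis by (rule order_trans[rotated])
qed

theorem theorem2p4:
  fixes \<nu>1 \<nu>2 :: real
  assumes "\<nu>1 \<in> {0<..<1}" and "\<nu>2 \<in> {0<..<1}"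
  shows "\<exists>c1 > 0.
    (\<exists>c0 > 0. \<exists>N. \<forall>n \<ge> N. \<forall>p k m \<epsilon> \<delta> c Sk M.
       admissible \<nu>1 \<nu>2 c0 n p k m \<epsilon> \<delta> \<and> c < c1 \<and> top_k_rule n k Sk \<and>
       set_estimator n M \<and> edge_dp n \<epsilon> \<delta> M \<longrightarrow>
       (SUP \<rho> \<in> Theta_tilde n p \<epsilon> k m c.
          ennreal (measure_pmf.prob (estimate_pmf n p \<rho> M) {S. hamming_dist S (Sk \<rho>) > 2 * m}))
         \<ge> ennreal (1 / 10)) \<and>
    (\<forall>F :: real \<Rightarrow> real.
       (\<forall>x. F x \<in> {0..1}) \<and> (\<forall>x. F differentiable at x) \<and> strict_mono F \<and>
       (\<forall>x. F x = 1 - F (- x)) \<longrightarrow>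
       (\<exists>c0 > 0. \<exists>N. \<forall>n \<ge> N. \<forall>p k m \<epsilon> \<delta> c Sk M.
          admissible \<nu>1 \<nu>2 c0 n p k m \<epsilon> \<delta> \<and> c < c1 \<and> top_k_rule n k Sk \<and>
          set_estimator n M \<and> edge_dp n \<epsilon> \<delta> M \<longrightarrow>
          (SUP \<rho> \<in> Theta_tilde n p \<epsilon> k m c \<inter> parametric_model n F.
             ennreal (measure_pmf.prob (estimate_pmf n p \<rho> M) {S. hamming_dist S (Sk \<rho>) > 2 * m}))
            \<ge> ennreal (1 / 10)))"
proof (rule exI[of _ "\<nu>1 * \<nu>2 / 48"], intro conjI allI impI)
  have \<nu>: "0 < \<nu>1" "\<nu>1 < 1" "0 < \<nu>2" "\<nu>2 < 1" using assms by auto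
  show "0 < \<nu>1 * \<nu>2 / 48" using \<nu> by simp
  \<comment> \<open>Beyond this threshold n powr (\<nu>1 * \<nu>2 / 12) is at least 50.\<close>
  define N where "N = nat \<lceil>50 powr (12 / (\<nu>1 * \<nu>2))\<rceil>"
  have N: "50 powr (12 / (\<nu>1 * \<nu>2)) \<le> real n" if "N \<le> n" for n
    using that unfolding N_def by linarith
  show "\<exists>c0 > 0. \<exists>N. \<forall>n \<ge> N. \<forall>p k m \<epsilon> \<delta> c Sk M.
       admissible \<nu>1 \<nu>2 c0 n p k m \<epsilon> \<delta> \<and> c < \<nu>1 * \<nu>2 / 48 \<and> top_k_rule n k Sk \<and>
       set_estimator n M \<and> edge_dp n \<epsilon> \<delta> M \<longrightarrow>
       (SUP \<rho> \<in> Theta_tilde n p \<epsilon> k m c.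
          ennreal (measure_pmf.prob (estimate_pmf n p \<rho> M) {S. hamming_dist S (Sk \<rho>) > 2 * m}))
         \<ge> ennreal (1 / 10)"
  proof (intro exI[of _ "1/2"] exI[of _ N] conjI allI impI, goal_cases)
    case (2 n p k m \<epsilon> \<delta> c Sk M)
    note lower = SUP_lower_bound[where R = UNIV, unfolded Int_UNIV_right]
    show ?case by (rule lower[OF \<nu>]) (use 2 N in auto)
  qed simp
  fix F :: "real \<Rightarrow> real"
  assume F: "(\<forall>x. F x \<in> {0..1}) \<and> (\<forall>x. F differentiable at x) \<and> strict_mono F \<and>
    (\<forall>x. F x = 1 - F (- x))"
  have sym: "F x = 1 - F (- x)" for x using F by blast
  have F0: "F 0 = 1/2" using sym[of 0] by simp
  \<comment> \<open>For 0 < h \<le> c0 the value 1/2 + h lies between \<open>F 0\<close> and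
    \<open>F 1\<close>, hence is attained by continuity. So \<open>c0\<close> depends on
    \<open>F\<close>, whereas the bound on \<open>c\<close> does not.\<close>
  define c0 where "c0 = F 1 - 1/2"
  have c0: "0 < c0" "c0 \<le> 1/2"
  proof -
    have "F 0 < F 1" using F by (intro strict_monoD[of F]) auto
    moreover have "F 1 \<in> {0..1}" using F by blast
    ultimately show "0 < c0" "c0 \<le> 1/2" using F0 by (auto simp: c0_def)
  qed
  have range: "\<exists>g. F g = 1/2 + h" if "0 < h" "h \<le> c0" for h
  proof -
    have "isCont F x" for x using F by (simp add: differentiable_imp_continuous_within)
    then have "\<exists>g\<ge>0. g \<le> 1 \<and> F g = 1/2 + h"
      using that F0 by (intro IVT) (auto simp: c0_def)
    then show ?thesis by blast
  qed
  have R: "two_level S h \<in> parametric_model n F" if "0 < h" "h \<le> c0" for S h n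
    using range[OF that] two_level_parametric[of F, OF sym] by blast
  show "\<exists>c0 > 0. \<exists>N. \<forall>n \<ge> N. \<forall>p k m \<epsilon> \<delta> c Sk M.
          admissible \<nu>1 \<nu>2 c0 n p k m \<epsilon> \<delta> \<and> c < \<nu>1 * \<nu>2 / 48 \<and> top_k_rule n k Sk \<and>
          set_estimator n M \<and> edge_dp n \<epsilon> \<delta> M \<longrightarrow>
          (SUP \<rho> \<in> Theta_tilde n p \<epsilon> k m c \<inter> parametric_model n F.
             ennreal (measure_pmf.prob (estimate_pmf n p \<rho> M) {S. hamming_dist S (Sk \<rho>) > 2 * m}))
            \<ge> ennreal (1 / 10)"
  proof (intro exI[of _ c0] exI[of _ N] conjI allI impI, goal_cases)
    case (2 n p k m \<epsilon> \<delta> c Sk M)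
    show ?case by (rule SUP_lower_bound[OF \<nu>]) (use 2 N c0 R in auto)
  qed (rule c0)
qed

end
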